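(* Let $(A,\alpha_A)$ and $(H,\alpha_H)$ be both Hom-Lie algebras and Hom-Lie coalgebras, with linear maps $\triangleright:H\otimes A\to A$, $\triangleleft:H\otimes A\to H$, $\phi:A\to H\otimes A$, $\psi:H\to H\otimes A$, such that $(A,H)$ is a matched pair of Hom-Lie algebras (via $\triangleright,\triangleleft$) and a matched pair of Hom-Lie coalgebras (via $\phi,\psi$). Let $E=A\oplus H$ carry $\alpha_E=\alpha_A\oplus\alpha_H$, the bracket $$[(a,x),(b,y)]=([a,b]+x\triangleright b-y\triangleright a,\ [x,y]+x\triangleleft b-y\triangleleft a)$$ and the cobracket $$\delta_E(a)=\delta_A(a)+\phi(a)-\tau\phi(a),\qquad \delta_E(x)=\delta_H(x)+\psi(x)-\tau\psi(x).$$ Then $E$ (the double biproduct of $A$ and $H$) is a Hom-Lie bialgebra if and only if $(A,H)$ is a double matched pair, i.e. for all $a,b\in A$, $x,y\in H$: (BB5) $\delta_A(x\triangleright a)=\alpha_H(x)\triangleright a_1\otimes\alpha_A(a_2)+\alpha_A(a_1)\otimes\alpha_H(x)\triangleright a_2+x_{(0)}\triangleright\alpha_A(a)\otimes\alpha_A(x_{(1)})-\alpha_A(x_{(1)})\otimes x_{(0)}\triangleright\alpha_A(a)$; (BB6) $\delta_H(x\triangleleft a)=\alpha_H(x_1)\otimes x_2\triangleleft\alpha_A(a)+x_1\triangleleft\alpha_A(a)\otimes\alpha_H(x_2)+\alpha_H(a_{(-1)})\otimes\alpha_H(x)\triangleleft a_{(0)}-\alpha_H(x)\triangleleft a_{(0)}\otimes\alpha_H(a_{(-1)})$;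 (BB7) $\phi([a,b])=\alpha_H(a_{(-1)})\otimes[a_{(0)},\alpha_A(b)]+\alpha_H(b_{(-1)})\otimes[\alpha_A(a),b_{(0)}]+a_{(-1)}\triangleleft\alpha_A(b)\otimes\alpha_A(a_{(0)})-b_{(-1)}\triangleleft\alpha_A(a)\otimes\alpha_A(b_{(0)})$; (BB8) $\psi([x,y])=[\alpha_H(x),y_{(0)}]\otimes\alpha_A(y_{(1)})+[x_{(0)},\alpha_H(y)]\otimes\alpha_A(x_{(1)})+\alpha_H(y_{(0)})\otimes\alpha_H(x)\triangleright y_{(1)}-\alpha_H(x_{(0)})\otimes\alpha_H(y)\triangleright x_{(1)}$; (BB9) $\delta_A([a,b])=[\alpha_A(a),\delta_A(b)]+[\delta_A(a),\alpha_A(b)]-b_{(-1)}\triangleright\alpha_A(a)\otimes\alpha_A(b_{(0)})-\alpha_A(a_{(0)})\otimes a_{(-1)}\triangleright\alpha_A(b)+a_{(-1)}\triangleright\alpha_A(b)\otimes\alpha_A(a_{(0)})+\alpha_A(b_{(0)})\otimes b_{(-1)}\triangleright\alpha_A(a)$; (BB10) $\delta_H([x,y])=[\delta_H(x),\alpha_H(y)]+[\alpha_H(x),\delta_H(y)]-\alpha_H(x_{(0)})\otimes\alpha_H(y)\triangleleft x_{(1)}-\alpha_H(x)\triangleleft y_{(1)}\otimes\alpha_H(y_{(0)})+\alpha_H(y_{(0)})\otimes\alpha_H(x)\triangleleft y_{(1)}+\alpha_H(y)\triangleleft x_{(1)}\otimes\alpha_H(x_{(0)})$; (YDB) $\phi(x\triangleright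 a)+\psi(x\triangleleft a)=[\alpha_H(x),a_{(-1)}]\otimes\alpha_A(a_{(0)})+\alpha_H(a_{(-1)})\otimes\alpha_H(x)\triangleright a_{(0)}+\alpha_H(x_1)\otimes x_2\triangleright\alpha_A(a)+\alpha_H(x_{(0)})\otimes[x_{(1)},\alpha_A(a)]+x_{(0)}\triangleleft\alpha_A(a)\otimes\alpha_A(x_{(1)})+\alpha_H(x)\triangleleft a_1\otimes\alpha_A(a_2)$.
   Context: All vector spaces are over an algebraically closed field $k$ of characteristic different from 2 and 3. $\tau(x\otimes y)=y\otimes x$, $\tau_{12}(x\otimes y\otimes z)=y\otimes x\otimes z$, $\tau_{23}(x\otimes y\otimes z)=x\otimes z\otimes y$. A Hom-Lie algebra $(H,[\cdot,\cdot],\alpha_H)$: vector space with linear $\alpha_H:H\to H$ and skew-symmetric bilinear bracket with $[\alpha_H(x),[y,z]]+[\alpha_H(y),[z,x]]+[\alpha_H(z),[x,y]]=0$. A Hom-Lie coalgebra $(H,\delta,\alpha_H)$: $\delta=-\tau\delta$ and $(\alpha_H\otimes\delta)\delta=(\delta\otimes\alpha_H)\delta+\tau_{12}(\alpha_H\otimes\delta)\delta$. A Hom-Lie bialgebra is both at once, with $\delta([x,y])=[\alpha_H(x),\delta(y)]+[\delta(x),\alpha_H(y)]$. Here and below $[z,u_1\otimes u_2]:=[z,u_1]\otimes\alpha(u_2)+\alpha(u_1)\otimes[z,u_2]$ and $[u_1\otimes u_2,z]:=[u_1,z]\otimes\alpha(u_2)+\alpha(u_1)\otimes[u_2,z]$,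 with $\alpha$ the structure map of the space in question. Sigma notation (summation suppressed): $\delta(x)=x_1\otimes x_2$, $\phi(a)=a_{(-1)}\otimes a_{(0)}\in H\otimes A$, $\psi(x)=x_{(0)}\otimes x_{(1)}\in H\otimes A$. Matched pair of Hom-Lie algebras $(A,H,\triangleright,\triangleleft)$: $A,H$ are Hom-Lie algebras; $A$ is a left $H$-Hom-Lie module: $[x,y]\triangleright\alpha_A(a)=\alpha_H(x)\triangleright(y\triangleright a)-\alpha_H(y)\triangleright(x\triangleright a)$; $H$ is a right $A$-Hom-Lie module: $\alpha_H(x)\triangleleft[a,b]=(x\triangleleft a)\triangleleft\alpha_A(b)-(x\triangleleft b)\triangleleft\alpha_A(a)$; and (BB1) $\alpha_H(x)\triangleright[a,b]=[x\triangleright a,\alpha_A(b)]+[\alpha_A(a),x\triangleright b]+(x\triangleleft a)\triangleright\alpha_A(b)-(x\triangleleft b)\triangleright\alpha_A(a)$, (BB2) $[x,y]\triangleleft\alpha_A(a)=[\alpha_H(x),y\triangleleft a]+[x\triangleleft a,\alpha_H(y)]+\alpha_H(x)\triangleleft(y\triangleright a)-\alpha_H(y)\triangleleft(x\triangleright a)$. Matched pair of Hom-Lie coalgebras $(A,H,\phi,\psi)$: $A,H$ are Hom-Lie coalgebras; $A$ is a left $H$-Hom-Lie comodule: $\delta_H(a_{(-1)})\otimes\alpha_A(a_{(0)})=\alpha_H(a_{(-1)})\otimes\phi(a_{(0)})-\tau_{12}(\alpha_H(a_{(-1)})\otimes\phi(a_{(0)}))$; $H$ is a right $A$-Hom-Lie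 comodule: $\alpha_H(x_{(0)})\otimes\delta_A(x_{(1)})=\psi(x_{(0)})\otimes\alpha_A(x_{(1)})-\tau_{23}(\psi(x_{(0)})\otimes\alpha_A(x_{(1)}))$; and (BB3) $\alpha_H(a_{(-1)})\otimes\delta_A(a_{(0)})=\phi(a_1)\otimes\alpha_A(a_2)+\tau_{12}(\alpha_A(a_1)\otimes\phi(a_2))+\psi(a_{(-1)})\otimes\alpha_A(a_{(0)})-\tau_{23}(\psi(a_{(-1)})\otimes\alpha_A(a_{(0)}))$, (BB4) $\delta_H(x_{(0)})\otimes\alpha_A(x_{(1)})=\alpha_H(x_1)\otimes\psi(x_2)+\tau_{23}(\psi(x_1)\otimes\alpha_H(x_2))+\alpha_H(x_{(0)})\otimes\phi(x_{(1)})-\tau_{12}(\alpha_H(x_{(0)})\otimes\phi(x_{(1)}))$. *)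

theory Defs
  imports "HOL-Computational_Algebra.Polynomial" "HOL-Analysis.Product_Vector"
    "HOL-Library.Function_Algebras"
begin

section \<open>Tensor products over a field\<close>

text \<open>
  A vector space over 'k is a type together with a scaling s (locale vector_space), so a quotient
  type cannot depend on s. Tensors are therefore realised as functionals on the bilinear forms:
  the tensor of a and b is the functional f -> f a b, and the tensor product is the span of
  these functionals. Since bilinear forms over a field separate the points of the
  tensor product, this is a model of it; its universal property is proved below as
  tensor_space_universal.
\<close>

definition bilin ::
  "('k::field \<Rightarrow> 'a::ab_group_add \<Rightarrow> 'a) \<Rightarrow> ('k \<Rightarrow> 'b::ab_group_add \<Rightarrow> 'b)
    \<Rightarrow> ('k \<Rightarrow> 'c::ab_group_add \<Rightarrow> 'c) \<Rightarrow> ('a \<Rightarrow> 'b \<Rightarrow> 'c) \<Rightarrow> bool"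
  where "bilin sA sB sC f \<longleftrightarrow>
    (\<forall>b. Vector_Spaces.linear sA sC (\<lambda>a. f a b)) \<and>
    (\<forall>a. Vector_Spaces.linear sB sC (\<lambda>b. f a b))"

definition trilin ::
  "('k::field \<Rightarrow> 'a::ab_group_add \<Rightarrow> 'a) \<Rightarrow> ('k \<Rightarrow> 'b::ab_group_add \<Rightarrow> 'b)
    \<Rightarrow> ('k \<Rightarrow> 'c::ab_group_add \<Rightarrow> 'c) \<Rightarrow> ('k \<Rightarrow> 'd::ab_group_add \<Rightarrow> 'd)
    \<Rightarrow> ('a \<Rightarrow> 'b \<Rightarrow> 'c \<Rightarrow> 'd) \<Rightarrow> bool"
  where "trilin sA sB sC sD f \<longleftrightarrow>
    (\<forall>b c. Vector_Spaces.linear sA sD (\<lambda>a. f a b c)) \<and>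
    (\<forall>a c. Vector_Spaces.linear sB sD (\<lambda>b. f a b c)) \<and>
    (\<forall>a b. Vector_Spaces.linear sC sD (\<lambda>c. f a b c))"

definition fscale :: "'k::field \<Rightarrow> ('i \<Rightarrow> 'k) \<Rightarrow> ('i \<Rightarrow> 'k)"
  where "fscale r t = (\<lambda>i. r * t i)"

type_synonym ('a, 'b, 'k) tensor2 = "('a \<Rightarrow> 'b \<Rightarrow> 'k) \<Rightarrow> 'k"
type_synonym ('a, 'b, 'c, 'k) tensor3 = "('a \<Rightarrow> 'b \<Rightarrow> 'c \<Rightarrow> 'k) \<Rightarrow> 'k"

definition tens ::
  "'a::ab_group_add \<Rightarrow> ('k::field \<Rightarrow> 'a \<Rightarrow> 'a) \<Rightarrow> ('k \<Rightarrow> 'b \<Rightarrow> 'b) \<Rightarrow> 'b::ab_group_add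
    \<Rightarrow> ('a, 'b, 'k) tensor2"  ("(_ \<otimes>\<^bsub>_,_\<^esub> _)" [71, 0, 0, 71] 70)
  where "a \<otimes>\<^bsub>sA,sB\<^esub> b = (\<lambda>f. if bilin sA sB (*) f then f a b else 0)"

definition tens3 ::
  "('k::field \<Rightarrow> 'a::ab_group_add \<Rightarrow> 'a) \<Rightarrow> ('k \<Rightarrow> 'b::ab_group_add \<Rightarrow> 'b)
    \<Rightarrow> ('k \<Rightarrow> 'c::ab_group_add \<Rightarrow> 'c) \<Rightarrow> 'a \<Rightarrow> 'b \<Rightarrow> 'c \<Rightarrow> ('a, 'b, 'c, 'k) tensor3"
  where "tens3 sA sB sC a b c = (\<lambda>f. if trilin sA sB sC (*) f then f a b c else 0)"

definition tensor_space ::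
  "('k::field \<Rightarrow> 'a::ab_group_add \<Rightarrow> 'a) \<Rightarrow> ('k \<Rightarrow> 'b::ab_group_add \<Rightarrow> 'b)
    \<Rightarrow> ('a, 'b, 'k) tensor2 set"
  where "tensor_space sA sB = module.span fscale {a \<otimes>\<^bsub>sA,sB\<^esub> b | a b. True}"

text \<open>
  Sigma notation. For a bilinear F with values in some space of functionals,
  sweedler t (%u v. F u v) is the image of t under the linear map induced by F,
  i.e. the sum of F t1 t2 where t = t1 (x) t2 in sumless notation
  (see sweedler_tens and sweedler_linear).
\<close>

definition sweedler :: "('a, 'b, 'k) tensor2 \<Rightarrow> ('a \<Rightarrow> 'b \<Rightarrow> 'i \<Rightarrow> 'k) \<Rightarrow> 'i \<Rightarrow> 'k"
  where "sweedler t F = (\<lambda>i. t (\<lambda>u v. F u v i))"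

definition sweedler3 :: "('a, 'b, 'c, 'k) tensor3 \<Rightarrow> ('a \<Rightarrow> 'b \<Rightarrow> 'c \<Rightarrow> 'i \<Rightarrow> 'k) \<Rightarrow> 'i \<Rightarrow> 'k"
  where "sweedler3 t F = (\<lambda>i. t (\<lambda>u v w. F u v w i))"

text \<open>tau sA sB, tau12 sA sB sC and tau23 sA sB sC take the factors of their domain.\<close>

definition tau ::
  "('k::field \<Rightarrow> 'a::ab_group_add \<Rightarrow> 'a) \<Rightarrow> ('k \<Rightarrow> 'b::ab_group_add \<Rightarrow> 'b)
    \<Rightarrow> ('a, 'b, 'k) tensor2 \<Rightarrow> ('b, 'a, 'k) tensor2"
  where "tau sA sB t = sweedler t (\<lambda>x y. y \<otimes>\<^bsub>sB,sA\<^esub> x)"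

definition tau12 ::
  "('k::field \<Rightarrow> 'a::ab_group_add \<Rightarrow> 'a) \<Rightarrow> ('k \<Rightarrow> 'b::ab_group_add \<Rightarrow> 'b)
    \<Rightarrow> ('k \<Rightarrow> 'c::ab_group_add \<Rightarrow> 'c) \<Rightarrow> ('a, 'b, 'c, 'k) tensor3 \<Rightarrow> ('b, 'a, 'c, 'k) tensor3"
  where "tau12 sA sB sC t = sweedler3 t (\<lambda>x y z. tens3 sB sA sC y x z)"

definition tau23 ::
  "('k::field \<Rightarrow> 'a::ab_group_add \<Rightarrow> 'a) \<Rightarrow> ('k \<Rightarrow> 'b::ab_group_add \<Rightarrow> 'b)
    \<Rightarrow> ('k \<Rightarrow> 'c::ab_group_add \<Rightarrow> 'c) \<Rightarrow> ('a, 'b, 'c, 'k) tensor3 \<Rightarrow> ('a, 'c, 'b, 'k) tensor3"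
  where "tau23 sA sB sC t = sweedler3 t (\<lambda>x y z. tens3 sA sC sB x z y)"

text \<open>Tensoring a vector with a two-fold tensor, on the left and on the right.\<close>

definition tensL ::
  "('k::field \<Rightarrow> 'a::ab_group_add \<Rightarrow> 'a) \<Rightarrow> ('k \<Rightarrow> 'b::ab_group_add \<Rightarrow> 'b)
    \<Rightarrow> ('k \<Rightarrow> 'c::ab_group_add \<Rightarrow> 'c) \<Rightarrow> 'a \<Rightarrow> ('b, 'c, 'k) tensor2 \<Rightarrow> ('a, 'b, 'c, 'k) tensor3"
  where "tensL sA sB sC a t = sweedler t (\<lambda>b c. tens3 sA sB sC a b c)"

definition tensR ::
  "('k::field \<Rightarrow> 'a::ab_group_add \<Rightarrow> 'a) \<Rightarrow> ('k \<Rightarrow> 'b::ab_group_add \<Rightarrow> 'b)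
    \<Rightarrow> ('k \<Rightarrow> 'c::ab_group_add \<Rightarrow> 'c) \<Rightarrow> ('a, 'b, 'k) tensor2 \<Rightarrow> 'c \<Rightarrow> ('a, 'b, 'c, 'k) tensor3"
  where "tensR sA sB sC t c = sweedler t (\<lambda>a b. tens3 sA sB sC a b c)"

definition linear_to_tensor ::
  "('k::field \<Rightarrow> 'v::ab_group_add \<Rightarrow> 'v) \<Rightarrow> ('k \<Rightarrow> 'a::ab_group_add \<Rightarrow> 'a)
    \<Rightarrow> ('k \<Rightarrow> 'b::ab_group_add \<Rightarrow> 'b) \<Rightarrow> ('v \<Rightarrow> ('a, 'b, 'k) tensor2) \<Rightarrow> bool"
  where "linear_to_tensor sV sA sB f \<longleftrightarrow>
    Vector_Spaces.linear sV fscale f \<and> range f \<subseteq> tensor_space sA sB"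

subsection \<open>Adequacy of the model\<close>

lemma vector_space_fscale: "vector_space (fscale :: 'k::field \<Rightarrow> ('i \<Rightarrow> 'k) \<Rightarrow> _)"
  by unfold_locales (auto simp: fscale_def fun_eq_iff algebra_simps)

lemma linear_iff':
  "Vector_Spaces.linear s1 s2 f \<longleftrightarrow> vector_space s1 \<and> vector_space s2 \<and>
     (\<forall>x y. f (x + y) = f x + f y) \<and> (\<forall>r x. f (s1 r x) = s2 r (f x))"
  by (auto simp: Vector_Spaces.linear_def module_hom_def module_hom_axioms_def
      module_iff_vector_space)

lemma vector_space_field: "vector_space ((*) :: 'k::field \<Rightarrow> 'k \<Rightarrow> 'k)"
  by unfold_locales (auto simp: algebra_simps)

lemma bilin_tens:
  assumes "vector_space sA" "vector_space sB"
  shows "bilin sA sB fscale (\<lambda>a b. a \<otimes>\<^bsub>sA,sB\<^esub> b)"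
  unfolding bilin_def tens_def linear_iff'
  using assms vector_space_fscale by (auto simp: fun_eq_iff fscale_def)

lemma trilin_tens3:
  assumes "vector_space sA" "vector_space sB" "vector_space sC"
  shows "trilin sA sB sC fscale (tens3 sA sB sC)"
  unfolding trilin_def tens3_def linear_iff'
  using assms vector_space_fscale by (auto simp: fun_eq_iff fscale_def)

lemma sweedler_tens:
  assumes "bilin sA sB fscale F"
  shows "sweedler (a \<otimes>\<^bsub>sA,sB\<^esub> b) F = F a b"
proof -
  have "bilin sA sB (*) (\<lambda>u v. F u v i)" for i
    using assms vector_space_field unfolding bilin_def linear_iff' by (auto simp: fscale_def)
  then show ?thesis by (simp add: sweedler_def tens_def)
qed

lemma sweedler3_tens3:
  assumes "trilin sA sB sC fscale F"
  shows "sweedler3 (tens3 sA sB sC a b c) F = F a b c"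
proof -
  have "trilin sA sB sC (*) (\<lambda>u v w. F u v w i)" for i
    using assms vector_space_field unfolding trilin_def linear_iff' by (auto simp: fscale_def)
  then show ?thesis by (simp add: sweedler3_def tens3_def)
qed

lemma sweedler_linear: "Vector_Spaces.linear fscale fscale (\<lambda>t. sweedler t F)"
  unfolding linear_iff'
  by (auto simp: sweedler_def fscale_def fun_eq_iff vector_space_fscale)

lemma sweedler3_linear: "Vector_Spaces.linear fscale fscale (\<lambda>t. sweedler3 t F)"
  unfolding linear_iff'
  by (auto simp: sweedler3_def fscale_def fun_eq_iff vector_space_fscale)

lemma sum_fun_apply: "(\<Sum>i\<in>I. t i) x = (\<Sum>i\<in>I. t i x)"
  by (induction I rule: infinite_finite_induct) auto

theorem tensor_space_universal:
  fixes sA :: "'k::field \<Rightarrow> 'a::ab_group_add \<Rightarrow> 'a" and sB :: "'k \<Rightarrow> 'b::ab_group_add \<Rightarrow> 'b"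
    and sV :: "'k \<Rightarrow> 'v::ab_group_add \<Rightarrow> 'v"
  assumes f: "bilin sA sB sV f"
  shows "\<exists>L. Vector_Spaces.linear fscale sV L \<and> (\<forall>a b. L (a \<otimes>\<^bsub>sA,sB\<^esub> b) = f a b)"
    and "\<lbrakk>Vector_Spaces.linear fscale sV L; Vector_Spaces.linear fscale sV L';
          \<forall>a b. L (a \<otimes>\<^bsub>sA,sB\<^esub> b) = f a b; \<forall>a b. L' (a \<otimes>\<^bsub>sA,sB\<^esub> b) = f a b;
          t \<in> tensor_space sA sB\<rbrakk> \<Longrightarrow> L t = L' t"
proof -
  have vA: "vector_space sA" and vB: "vector_space sB" and vV: "vector_space sV"
    using f unfolding bilin_def linear_iff' by auto
  interpret A: vector_space sA by fact
  interpret B: vector_space sB by fact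
  interpret V: vector_space sV by fact
  interpret T: vector_space "fscale :: 'k \<Rightarrow> ('a, 'b, 'k) tensor2 \<Rightarrow> _"
    by (rule vector_space_fscale)
  interpret TV: vector_space_pair "fscale :: 'k \<Rightarrow> ('a, 'b, 'k) tensor2 \<Rightarrow> _" sV ..
  interpret AV: vector_space_pair sA sV ..
  interpret BV: vector_space_pair sB sV ..
  define X where "X = A.extend_basis {}"
  define Y where "Y = B.extend_basis {}"
  have X: "A.independent X" "A.span X = UNIV" and Y: "B.independent Y" "B.span Y = UNIV"
    unfolding X_def Y_def
    by (auto simp: A.independent_extend_basis B.independent_extend_basis
        A.span_extend_basis B.span_extend_basis A.independent_empty B.independent_empty)
  define d where "d i j = (\<lambda>a b. A.representation X a i * B.representation Y b j)" for i j
  have d: "bilin sA sB (*) (d i j)" for i j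
    unfolding bilin_def linear_iff' d_def using vA vB vector_space_field X Y
    by (auto simp: A.representation_add B.representation_add A.representation_scale
        B.representation_scale algebra_simps)
  have d_tens: "(a \<otimes>\<^bsub>sA,sB\<^esub> b) (d i j) = (if a = i \<and> b = j then 1 else 0)"
    if "a \<in> X" "b \<in> Y" for a b i j
    using that d by (auto simp: tens_def d_def A.representation_basis[OF X(1)]
        B.representation_basis[OF Y(1)])
  define P where "P = (\<lambda>(i, j). i \<otimes>\<^bsub>sA,sB\<^esub> j) ` (X \<times> Y)"
  have inj: "a = a' \<and> b = b'"
    if "a \<in> X" "b \<in> Y" "a' \<in> X" "b' \<in> Y" "a \<otimes>\<^bsub>sA,sB\<^esub> b = a' \<otimes>\<^bsub>sA,sB\<^esub> b'" for a b a' b'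
    using d_tens[of a b a' b'] d_tens[of a' b' a' b'] that by (auto split: if_splits)
  have "T.independent P"
  proof
    assume "T.dependent P"
    then obtain S u v where S: "finite S" "S \<subseteq> P" "(\<Sum>p\<in>S. fscale (u p) p) = 0" "v \<in> S" "u v \<noteq> 0"
      unfolding T.dependent_explicit by blast
    obtain i j where ij: "i \<in> X" "j \<in> Y" "v = i \<otimes>\<^bsub>sA,sB\<^esub> j" using S unfolding P_def by auto
    have "0 = (\<Sum>p\<in>S. fscale (u p) p) (d i j)" using S by simp
    also have "\<dots> = (\<Sum>p\<in>S. u p * p (d i j))" by (simp add: sum_fun_apply fscale_def)
    also have "\<dots> = (\<Sum>p\<in>S. if p = v then u p else 0)"
    proof (rule sum.cong[OF refl])
      fix p assume "p \<in> S"
      then obtain i' j' where "i' \<in> X" "j' \<in> Y" "p = i' \<otimes>\<^bsub>sA,sB\<^esub> j'"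
        using S unfolding P_def by auto
      then show "u p * p (d i j) = (if p = v then u p else 0)"
        using inj[of i' j' i j] ij by (auto simp: d_tens)
    qed
    also have "\<dots> = u v" using S by simp
    finally show False using S by simp
  qed
  define g where "g p = (let (i, j) = (SOME (i, j). i \<in> X \<and> j \<in> Y \<and> p = i \<otimes>\<^bsub>sA,sB\<^esub> j) in f i j)" for p
  have g: "g (i \<otimes>\<^bsub>sA,sB\<^esub> j) = f i j" if "i \<in> X" "j \<in> Y" for i j
  proof -
    have "(SOME (i', j'). i' \<in> X \<and> j' \<in> Y \<and> i \<otimes>\<^bsub>sA,sB\<^esub> j = i' \<otimes>\<^bsub>sA,sB\<^esub> j') = (i, j)"
      by (rule some_equality) (use that inj in auto)
    then show ?thesis by (simp add: g_def)
  qed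
  define L where "L = TV.construct P g"
  have L: "Vector_Spaces.linear fscale sV L"
    unfolding L_def by (rule TV.linear_construct) fact
  have LP: "L (i \<otimes>\<^bsub>sA,sB\<^esub> j) = f i j" if "i \<in> X" "j \<in> Y" for i j
    using that g unfolding L_def
    by (subst TV.construct_basis) (use \<open>T.independent P\<close> in \<open>auto simp: P_def\<close>)
  note bt = bilin_tens[OF vA vB]
  have linA: "Vector_Spaces.linear sA sV (\<lambda>a. L (a \<otimes>\<^bsub>sA,sB\<^esub> b))" for b
    using bt L unfolding bilin_def linear_iff' by auto
  have linB: "Vector_Spaces.linear sB sV (\<lambda>b. L (a \<otimes>\<^bsub>sA,sB\<^esub> b))" for a
    using bt L unfolding bilin_def linear_iff' by auto
  have fA: "Vector_Spaces.linear sA sV (\<lambda>a. f a b)" for b using f unfolding bilin_def by auto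
  have fB: "Vector_Spaces.linear sB sV (\<lambda>b. f a b)" for a using f unfolding bilin_def by auto
  have 1: "L (i \<otimes>\<^bsub>sA,sB\<^esub> b) = f i b" if "i \<in> X" for i b
    using BV.linear_eq_on[OF linB fB, of b Y] that LP Y(2) by blast
  have "L (a \<otimes>\<^bsub>sA,sB\<^esub> b) = f a b" for a b
    using AV.linear_eq_on[OF linA fA, of a X] 1 X(2) by blast
  with L show "\<exists>L. Vector_Spaces.linear fscale sV L \<and> (\<forall>a b. L (a \<otimes>\<^bsub>sA,sB\<^esub> b) = f a b)"
    by blast
  show "L t = L' t" if "Vector_Spaces.linear fscale sV L" "Vector_Spaces.linear fscale sV L'"
    "\<forall>a b. L (a \<otimes>\<^bsub>sA,sB\<^esub> b) = f a b" "\<forall>a b. L' (a \<otimes>\<^bsub>sA,sB\<^esub> b) = f a b"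
    "t \<in> tensor_space sA sB" for L L'
  proof (rule TV.linear_eq_on[OF that(1,2)])
    show "t \<in> T.span {a \<otimes>\<^bsub>sA,sB\<^esub> b | a b. True}" using that(5) unfolding tensor_space_def .
  qed (use that(3,4) in auto)
qed


section \<open>Hom-Lie algebras, coalgebras and bialgebras\<close>

locale hom_lie_algebra = vector_space scale
  for scale :: "'k::field \<Rightarrow> 'v::ab_group_add \<Rightarrow> 'v" +
  fixes bracket :: "'v \<Rightarrow> 'v \<Rightarrow> 'v" and \<alpha> :: "'v \<Rightarrow> 'v"
  assumes linear_\<alpha>: "Vector_Spaces.linear scale scale \<alpha>"
    and bilin_bracket: "bilin scale scale scale bracket"
    and skew: "bracket x y = - bracket y x"
    and hom_jacobi:
      "bracket (\<alpha> x) (bracket y z) + bracket (\<alpha> y) (bracket z x) + bracket (\<alpha> z) (bracket x y) = 0"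

locale hom_lie_coalgebra = vector_space scale
  for scale :: "'k::field \<Rightarrow> 'v::ab_group_add \<Rightarrow> 'v" +
  fixes \<delta> :: "'v \<Rightarrow> ('v, 'v, 'k) tensor2" and \<alpha> :: "'v \<Rightarrow> 'v"
  assumes linear_\<alpha>: "Vector_Spaces.linear scale scale \<alpha>"
    and linear_\<delta>: "linear_to_tensor scale scale scale \<delta>"
    and coskew: "\<delta> x = - tau scale scale (\<delta> x)"
    and hom_cojacobi:
      "sweedler (\<delta> x) (\<lambda>x1 x2. tensL scale scale scale (\<alpha> x1) (\<delta> x2)) =
         sweedler (\<delta> x) (\<lambda>x1 x2. tensR scale scale scale (\<delta> x1) (\<alpha> x2)) +
         tau12 scale scale scale (sweedler (\<delta> x) (\<lambda>x1 x2. tensL scale scale scale (\<alpha> x1) (\<delta> x2)))"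

text \<open>The brackets [z, t] and [t, z] of a vector z with a two-fold tensor t.\<close>

definition brL ::
  "('k::field \<Rightarrow> 'v::ab_group_add \<Rightarrow> 'v) \<Rightarrow> ('v \<Rightarrow> 'v \<Rightarrow> 'v) \<Rightarrow> ('v \<Rightarrow> 'v)
    \<Rightarrow> 'v \<Rightarrow> ('v, 'v, 'k) tensor2 \<Rightarrow> ('v, 'v, 'k) tensor2"
  where "brL s br \<alpha> z t = sweedler t (\<lambda>u1 u2. br z u1 \<otimes>\<^bsub>s,s\<^esub> \<alpha> u2 + \<alpha> u1 \<otimes>\<^bsub>s,s\<^esub> br z u2)"

definition brR ::
  "('k::field \<Rightarrow> 'v::ab_group_add \<Rightarrow> 'v) \<Rightarrow> ('v \<Rightarrow> 'v \<Rightarrow> 'v) \<Rightarrow> ('v \<Rightarrow> 'v)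
    \<Rightarrow> ('v, 'v, 'k) tensor2 \<Rightarrow> 'v \<Rightarrow> ('v, 'v, 'k) tensor2"
  where "brR s br \<alpha> t z = sweedler t (\<lambda>u1 u2. br u1 z \<otimes>\<^bsub>s,s\<^esub> \<alpha> u2 + \<alpha> u1 \<otimes>\<^bsub>s,s\<^esub> br u2 z)"

locale hom_lie_bialgebra = hom_lie_algebra scale bracket \<alpha> + hom_lie_coalgebra scale \<delta> \<alpha>
  for scale :: "'k::field \<Rightarrow> 'v::ab_group_add \<Rightarrow> 'v" and bracket \<delta> \<alpha> +
  assumes compat:
    "\<delta> (bracket x y) = brL scale bracket \<alpha> (\<alpha> x) (\<delta> y) + brR scale bracket \<alpha> (\<delta> x) (\<alpha> y)"


section \<open>Modules, comodules and matched pairs\<close>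

text \<open>
  A linear map out of a tensor product, such as an action, is given as the corresponding
  bilinear map.
\<close>

locale left_hom_lie_module =
  H: hom_lie_algebra sH brH \<alpha>H + V: vector_space sV
  for sH :: "'k::field \<Rightarrow> 'h::ab_group_add \<Rightarrow> 'h" and brH \<alpha>H
    and sV :: "'k \<Rightarrow> 'v::ab_group_add \<Rightarrow> 'v" +
  fixes \<alpha>V :: "'v \<Rightarrow> 'v" and act :: "'h \<Rightarrow> 'v \<Rightarrow> 'v"
  assumes linear_\<alpha>V: "Vector_Spaces.linear sV sV \<alpha>V"
    and bilin_act: "bilin sH sV sV act"
    and left_module: "act (brH x y) (\<alpha>V a) = act (\<alpha>H x) (act y a) - act (\<alpha>H y) (act x a)"

locale right_hom_lie_module =
  A: hom_lie_algebra sA brA \<alpha>A + V: vector_space sV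
  for sA :: "'k::field \<Rightarrow> 'a::ab_group_add \<Rightarrow> 'a" and brA \<alpha>A
    and sV :: "'k \<Rightarrow> 'v::ab_group_add \<Rightarrow> 'v" +
  fixes \<alpha>V :: "'v \<Rightarrow> 'v" and ract :: "'v \<Rightarrow> 'a \<Rightarrow> 'v"
  assumes linear_\<alpha>V: "Vector_Spaces.linear sV sV \<alpha>V"
    and bilin_ract: "bilin sV sA sV ract"
    and right_module: "ract (\<alpha>V x) (brA a b) = ract (ract x a) (\<alpha>A b) - ract (ract x b) (\<alpha>A a)"

locale matched_pair_hom_lie_algebras =
  A: hom_lie_algebra sA brA \<alpha>A + H: hom_lie_algebra sH brH \<alpha>H +
  A_mod: left_hom_lie_module sH brH \<alpha>H sA \<alpha>A act +
  H_mod: right_hom_lie_module sA brA \<alpha>A sH \<alpha>H ract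
  for sA :: "'k::field \<Rightarrow> 'a::ab_group_add \<Rightarrow> 'a" and brA \<alpha>A
    and sH :: "'k \<Rightarrow> 'h::ab_group_add \<Rightarrow> 'h" and brH \<alpha>H
    and act :: "'h \<Rightarrow> 'a \<Rightarrow> 'a"  (infixr "\<triangleright>" 75)
    and ract :: "'h \<Rightarrow> 'a \<Rightarrow> 'h"  (infixl "\<triangleleft>" 75) +
  assumes BB1: "\<alpha>H x \<triangleright> brA a b =
      brA (x \<triangleright> a) (\<alpha>A b) + brA (\<alpha>A a) (x \<triangleright> b) + (x \<triangleleft> a) \<triangleright> \<alpha>A b - (x \<triangleleft> b) \<triangleright> \<alpha>A a"
    and BB2: "brH x y \<triangleleft> \<alpha>A a =
      brH (\<alpha>H x) (y \<triangleleft> a) + brH (x \<triangleleft> a) (\<alpha>H y) + \<alpha>H x \<triangleleft> (y \<triangleright> a) - \<alpha>H y \<triangleleft> (x \<triangleright> a)"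

locale left_hom_lie_comodule =
  H: hom_lie_coalgebra sH \<delta>H \<alpha>H + V: vector_space sV
  for sH :: "'k::field \<Rightarrow> 'h::ab_group_add \<Rightarrow> 'h" and \<delta>H \<alpha>H
    and sV :: "'k \<Rightarrow> 'v::ab_group_add \<Rightarrow> 'v" +
  fixes \<alpha>V :: "'v \<Rightarrow> 'v" and \<phi> :: "'v \<Rightarrow> ('h, 'v, 'k) tensor2"
  assumes linear_\<alpha>V: "Vector_Spaces.linear sV sV \<alpha>V"
    and linear_\<phi>: "linear_to_tensor sV sH sV \<phi>"
    and left_comodule:
      "sweedler (\<phi> a) (\<lambda>a' a0. tensR sH sH sV (\<delta>H a') (\<alpha>V a0)) =
         sweedler (\<phi> a) (\<lambda>a' a0. tensL sH sH sV (\<alpha>H a') (\<phi> a0)) -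
         tau12 sH sH sV (sweedler (\<phi> a) (\<lambda>a' a0. tensL sH sH sV (\<alpha>H a') (\<phi> a0)))"

locale right_hom_lie_comodule =
  A: hom_lie_coalgebra sA \<delta>A \<alpha>A + V: vector_space sV
  for sA :: "'k::field \<Rightarrow> 'a::ab_group_add \<Rightarrow> 'a" and \<delta>A \<alpha>A
    and sV :: "'k \<Rightarrow> 'v::ab_group_add \<Rightarrow> 'v" +
  fixes \<alpha>V :: "'v \<Rightarrow> 'v" and \<psi> :: "'v \<Rightarrow> ('v, 'a, 'k) tensor2"
  assumes linear_\<alpha>V: "Vector_Spaces.linear sV sV \<alpha>V"
    and linear_\<psi>: "linear_to_tensor sV sV sA \<psi>"
    and right_comodule:
      "sweedler (\<psi> x) (\<lambda>x0 x1. tensL sV sA sA (\<alpha>V x0) (\<delta>A x1)) =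
         sweedler (\<psi> x) (\<lambda>x0 x1. tensR sV sA sA (\<psi> x0) (\<alpha>A x1)) -
         tau23 sV sA sA (sweedler (\<psi> x) (\<lambda>x0 x1. tensR sV sA sA (\<psi> x0) (\<alpha>A x1)))"

text \<open>In a' and a0 below, a' is the (-1)-component and a0 the 0-component of the coaction on a.\<close>

locale matched_pair_hom_lie_coalgebras =
  A: hom_lie_coalgebra sA \<delta>A \<alpha>A + H: hom_lie_coalgebra sH \<delta>H \<alpha>H +
  A_comod: left_hom_lie_comodule sH \<delta>H \<alpha>H sA \<alpha>A \<phi> +
  H_comod: right_hom_lie_comodule sA \<delta>A \<alpha>A sH \<alpha>H \<psi>
  for sA :: "'k::field \<Rightarrow> 'a::ab_group_add \<Rightarrow> 'a" and \<delta>A \<alpha>A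
    and sH :: "'k \<Rightarrow> 'h::ab_group_add \<Rightarrow> 'h" and \<delta>H \<alpha>H
    and \<phi> :: "'a \<Rightarrow> ('h, 'a, 'k) tensor2" and \<psi> :: "'h \<Rightarrow> ('h, 'a, 'k) tensor2" +
  assumes BB3:
      "sweedler (\<phi> a) (\<lambda>a' a0. tensL sH sA sA (\<alpha>H a') (\<delta>A a0)) =
         sweedler (\<delta>A a) (\<lambda>a1 a2. tensR sH sA sA (\<phi> a1) (\<alpha>A a2)) +
         tau12 sA sH sA (sweedler (\<delta>A a) (\<lambda>a1 a2. tensL sA sH sA (\<alpha>A a1) (\<phi> a2))) +
         sweedler (\<phi> a) (\<lambda>a' a0. tensR sH sA sA (\<psi> a') (\<alpha>A a0)) -
         tau23 sH sA sA (sweedler (\<phi> a) (\<lambda>a' a0. tensR sH sA sA (\<psi> a') (\<alpha>A a0)))"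
    and BB4:
      "sweedler (\<psi> x) (\<lambda>x0 x1. tensR sH sH sA (\<delta>H x0) (\<alpha>A x1)) =
         sweedler (\<delta>H x) (\<lambda>x1 x2. tensL sH sH sA (\<alpha>H x1) (\<psi> x2)) +
         tau23 sH sA sH (sweedler (\<delta>H x) (\<lambda>x1 x2. tensR sH sA sH (\<psi> x1) (\<alpha>H x2))) +
         sweedler (\<psi> x) (\<lambda>x0 x1. tensL sH sH sA (\<alpha>H x0) (\<phi> x1)) -
         tau12 sH sH sA (sweedler (\<psi> x) (\<lambda>x0 x1. tensL sH sH sA (\<alpha>H x0) (\<phi> x1)))"

locale double_matched_pair =
  matched_pair_hom_lie_algebras sA brA \<alpha>A sH brH \<alpha>H act ract +
  matched_pair_hom_lie_coalgebras sA \<delta>A \<alpha>A sH \<delta>H \<alpha>H \<phi> \<psi>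
  for sA :: "'k::field \<Rightarrow> 'a::ab_group_add \<Rightarrow> 'a" and brA \<delta>A \<alpha>A
    and sH :: "'k \<Rightarrow> 'h::ab_group_add \<Rightarrow> 'h" and brH \<delta>H \<alpha>H
    and act :: "'h \<Rightarrow> 'a \<Rightarrow> 'a"  (infixr "\<triangleright>" 75)
    and ract :: "'h \<Rightarrow> 'a \<Rightarrow> 'h"  (infixl "\<triangleleft>" 75)
    and \<phi> \<psi> +
  assumes BB5: "\<delta>A (x \<triangleright> a) =
        sweedler (\<delta>A a) (\<lambda>a1 a2. (\<alpha>H x \<triangleright> a1) \<otimes>\<^bsub>sA,sA\<^esub> \<alpha>A a2)
      + sweedler (\<delta>A a) (\<lambda>a1 a2. \<alpha>A a1 \<otimes>\<^bsub>sA,sA\<^esub> (\<alpha>H x \<triangleright> a2))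
      + sweedler (\<psi> x) (\<lambda>x0 x1. (x0 \<triangleright> \<alpha>A a) \<otimes>\<^bsub>sA,sA\<^esub> \<alpha>A x1)
      - sweedler (\<psi> x) (\<lambda>x0 x1. \<alpha>A x1 \<otimes>\<^bsub>sA,sA\<^esub> (x0 \<triangleright> \<alpha>A a))"
    and BB6: "\<delta>H (x \<triangleleft> a) =
        sweedler (\<delta>H x) (\<lambda>x1 x2. \<alpha>H x1 \<otimes>\<^bsub>sH,sH\<^esub> (x2 \<triangleleft> \<alpha>A a))
      + sweedler (\<delta>H x) (\<lambda>x1 x2. (x1 \<triangleleft> \<alpha>A a) \<otimes>\<^bsub>sH,sH\<^esub> \<alpha>H x2)
      + sweedler (\<phi> a) (\<lambda>a' a0. \<alpha>H a' \<otimes>\<^bsub>sH,sH\<^esub> (\<alpha>H x \<triangleleft> a0))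
      - sweedler (\<phi> a) (\<lambda>a' a0. (\<alpha>H x \<triangleleft> a0) \<otimes>\<^bsub>sH,sH\<^esub> \<alpha>H a')"
    and BB7: "\<phi> (brA a b) =
        sweedler (\<phi> a) (\<lambda>a' a0. \<alpha>H a' \<otimes>\<^bsub>sH,sA\<^esub> brA a0 (\<alpha>A b))
      + sweedler (\<phi> b) (\<lambda>b' b0. \<alpha>H b' \<otimes>\<^bsub>sH,sA\<^esub> brA (\<alpha>A a) b0)
      + sweedler (\<phi> a) (\<lambda>a' a0. (a' \<triangleleft> \<alpha>A b) \<otimes>\<^bsub>sH,sA\<^esub> \<alpha>A a0)
      - sweedler (\<phi> b) (\<lambda>b' b0. (b' \<triangleleft> \<alpha>A a) \<otimes>\<^bsub>sH,sA\<^esub> \<alpha>A b0)"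
    and BB8: "\<psi> (brH x y) =
        sweedler (\<psi> y) (\<lambda>y0 y1. brH (\<alpha>H x) y0 \<otimes>\<^bsub>sH,sA\<^esub> \<alpha>A y1)
      + sweedler (\<psi> x) (\<lambda>x0 x1. brH x0 (\<alpha>H y) \<otimes>\<^bsub>sH,sA\<^esub> \<alpha>A x1)
      + sweedler (\<psi> y) (\<lambda>y0 y1. \<alpha>H y0 \<otimes>\<^bsub>sH,sA\<^esub> (\<alpha>H x \<triangleright> y1))
      - sweedler (\<psi> x) (\<lambda>x0 x1. \<alpha>H x0 \<otimes>\<^bsub>sH,sA\<^esub> (\<alpha>H y \<triangleright> x1))"
    and BB9: "\<delta>A (brA a b) =
        brL sA brA \<alpha>A (\<alpha>A a) (\<delta>A b) + brR sA brA \<alpha>A (\<delta>A a) (\<alpha>A b)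
      - sweedler (\<phi> b) (\<lambda>b' b0. (b' \<triangleright> \<alpha>A a) \<otimes>\<^bsub>sA,sA\<^esub> \<alpha>A b0)
      - sweedler (\<phi> a) (\<lambda>a' a0. \<alpha>A a0 \<otimes>\<^bsub>sA,sA\<^esub> (a' \<triangleright> \<alpha>A b))
      + sweedler (\<phi> a) (\<lambda>a' a0. (a' \<triangleright> \<alpha>A b) \<otimes>\<^bsub>sA,sA\<^esub> \<alpha>A a0)
      + sweedler (\<phi> b) (\<lambda>b' b0. \<alpha>A b0 \<otimes>\<^bsub>sA,sA\<^esub> (b' \<triangleright> \<alpha>A a))"
    and BB10: "\<delta>H (brH x y) =
        brR sH brH \<alpha>H (\<delta>H x) (\<alpha>H y) + brL sH brH \<alpha>H (\<alpha>H x) (\<delta>H y)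
      - sweedler (\<psi> x) (\<lambda>x0 x1. \<alpha>H x0 \<otimes>\<^bsub>sH,sH\<^esub> (\<alpha>H y \<triangleleft> x1))
      - sweedler (\<psi> y) (\<lambda>y0 y1. (\<alpha>H x \<triangleleft> y1) \<otimes>\<^bsub>sH,sH\<^esub> \<alpha>H y0)
      + sweedler (\<psi> y) (\<lambda>y0 y1. \<alpha>H y0 \<otimes>\<^bsub>sH,sH\<^esub> (\<alpha>H x \<triangleleft> y1))
      + sweedler (\<psi> x) (\<lambda>x0 x1. (\<alpha>H y \<triangleleft> x1) \<otimes>\<^bsub>sH,sH\<^esub> \<alpha>H x0)"
    and YDB: "\<phi> (x \<triangleright> a) + \<psi> (x \<triangleleft> a) =
        sweedler (\<phi> a) (\<lambda>a' a0. brH (\<alpha>H x) a' \<otimes>\<^bsub>sH,sA\<^esub> \<alpha>A a0)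
      + sweedler (\<phi> a) (\<lambda>a' a0. \<alpha>H a' \<otimes>\<^bsub>sH,sA\<^esub> (\<alpha>H x \<triangleright> a0))
      + sweedler (\<delta>H x) (\<lambda>x1 x2. \<alpha>H x1 \<otimes>\<^bsub>sH,sA\<^esub> (x2 \<triangleright> \<alpha>A a))
      + sweedler (\<psi> x) (\<lambda>x0 x1. \<alpha>H x0 \<otimes>\<^bsub>sH,sA\<^esub> brA x1 (\<alpha>A a))
      + sweedler (\<psi> x) (\<lambda>x0 x1. (x0 \<triangleleft> \<alpha>A a) \<otimes>\<^bsub>sH,sA\<^esub> \<alpha>A x1)
      + sweedler (\<delta>A a) (\<lambda>a1 a2. (\<alpha>H x \<triangleleft> a1) \<otimes>\<^bsub>sH,sA\<^esub> \<alpha>A a2)"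


section \<open>The double biproduct\<close>

definition biproduct_bracket ::
  "('a::ab_group_add \<Rightarrow> 'a \<Rightarrow> 'a) \<Rightarrow> ('h::ab_group_add \<Rightarrow> 'h \<Rightarrow> 'h)
    \<Rightarrow> ('h \<Rightarrow> 'a \<Rightarrow> 'a) \<Rightarrow> ('h \<Rightarrow> 'a \<Rightarrow> 'h) \<Rightarrow> 'a \<times> 'h \<Rightarrow> 'a \<times> 'h \<Rightarrow> 'a \<times> 'h"
  where "biproduct_bracket brA brH act ract = (\<lambda>(a, x) (b, y).
    (brA a b + act x b - act y a, brH x y + ract x b - ract y a))"

text \<open>
  The cobracket is the linear extension of its values on the two summands; the four subspaces
  A (x) A, H (x) A, A (x) H and H (x) H of E (x) E are embedded along A -> E and H -> E.
\<close>

definition biproduct_cobracket ::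
  "('k::field \<Rightarrow> 'a::ab_group_add \<Rightarrow> 'a) \<Rightarrow> ('k \<Rightarrow> 'h::ab_group_add \<Rightarrow> 'h)
    \<Rightarrow> ('a \<Rightarrow> ('a, 'a, 'k) tensor2) \<Rightarrow> ('h \<Rightarrow> ('h, 'h, 'k) tensor2)
    \<Rightarrow> ('a \<Rightarrow> ('h, 'a, 'k) tensor2) \<Rightarrow> ('h \<Rightarrow> ('h, 'a, 'k) tensor2)
    \<Rightarrow> 'a \<times> 'h \<Rightarrow> ('a \<times> 'h, 'a \<times> 'h, 'k) tensor2"
  where "biproduct_cobracket sA sH \<delta>A \<delta>H \<phi> \<psi> =
    (let sE = module_prod.scale sA sH;
         AA = (\<lambda>t. sweedler t (\<lambda>a b. (a, 0) \<otimes>\<^bsub>sE,sE\<^esub> (b, 0)));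
         HA = (\<lambda>t. sweedler t (\<lambda>x a. (0, x) \<otimes>\<^bsub>sE,sE\<^esub> (a, 0)));
         AH = (\<lambda>t. sweedler t (\<lambda>a x. (a, 0) \<otimes>\<^bsub>sE,sE\<^esub> (0, x)));
         HH = (\<lambda>t. sweedler t (\<lambda>x y. (0, x) \<otimes>\<^bsub>sE,sE\<^esub> (0, y)))
     in (\<lambda>(a, x).
       (AA (\<delta>A a) + HA (\<phi> a) - AH (tau sH sA (\<phi> a))) +
       (HH (\<delta>H x) + HA (\<psi> x) - AH (tau sH sA (\<psi> x)))))"

end

(* A tensor t is a functional on bilinear forms, so an identity between tensors is an identity of
   scalars for every bilinear form, and t is additive in the form. A bilinear form on E = A + H is
   the sum of its four restrictions to A x A, A x H, H x A and H x H, a trilinear form that of its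
   eight. Evaluating the compatibility condition of E blockwise, the A x A block gives BB5 and BB9,
   the H x H block BB6 and BB10 and the H x A block BB7, BB8 and YDB, while the A x H block
   repeats the H x A block by coskew-symmetry. In the same way the co-Jacobi identity of E
   splits into the co-Jacobi identities of A and H, the two comodule axioms, BB3 and BB4. *)

theory Submission
  imports Defs
begin

section \<open>Tensors as functionals on multilinear forms\<close>

lemma bilin_iff:
  "bilin sA sB (*) f \<longleftrightarrow> vector_space sA \<and> vector_space sB \<and>
    (\<forall>x y z. f (x + y) z = f x z + f y z) \<and> (\<forall>x y z. f x (y + z) = f x y + f x z) \<and>
    (\<forall>r x y. f (sA r x) y = r * f x y) \<and> (\<forall>r x y. f x (sB r y) = r * f x y)"
  using vector_space_field unfolding bilin_def linear_iff' by blast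

lemma trilin_iff:
  "trilin sA sB sC (*) f \<longleftrightarrow> vector_space sA \<and> vector_space sB \<and> vector_space sC \<and>
    (\<forall>x x' y z. f (x + x') y z = f x y z + f x' y z) \<and>
    (\<forall>x y y' z. f x (y + y') z = f x y z + f x y' z) \<and>
    (\<forall>x y z z'. f x y (z + z') = f x y z + f x y z') \<and>
    (\<forall>r x y z. f (sA r x) y z = r * f x y z) \<and>
    (\<forall>r x y z. f x (sB r y) z = r * f x y z) \<and>
    (\<forall>r x y z. f x y (sC r z) = r * f x y z)"
  using vector_space_field unfolding trilin_def linear_iff' by auto

lemma linearD:
  assumes "Vector_Spaces.linear s1 s2 f"
  shows "f (x + y) = f x + f y" "f (s1 r x) = s2 r (f x)" "f 0 = 0" "f (- x) = - f x"
    "f (x - y) = f x - f y"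
proof -
  interpret Vector_Spaces.linear s1 s2 f by fact
  show "f (x + y) = f x + f y" "f (s1 r x) = s2 r (f x)" "f 0 = 0" "f (- x) = - f x"
    "f (x - y) = f x - f y" by (simp_all add: add scale neg diff)
qed

lemma bilinD:
  assumes "bilin sA sB sC f"
  shows "f (x + x') y = f x y + f x' y" "f (sA r x) y = sC r (f x y)" "f 0 y = 0"
    "f (- x) y = - f x y" "f (x - x') y = f x y - f x' y"
    "f x (y + y') = f x y + f x y'" "f x (sB r y) = sC r (f x y)" "f x 0 = 0"
    "f x (- y) = - f x y" "f x (y - y') = f x y - f x y'"
  using assms linearD[of sA sC "\<lambda>x. f x y"] linearD[of sB sC "\<lambda>y. f x y"]
  unfolding bilin_def by auto

text \<open>
  The first two groups are equations between functions, because a form with its last argument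
  free appears eta-contracted below the functionals.
\<close>

lemma trilinD:
  assumes "trilin sA sB sC sD f"
  shows "f (x + x') = (\<lambda>y z. f x y z + f x' y z)" "f (sA r x) = (\<lambda>y z. sD r (f x y z))"
    "f 0 = (\<lambda>y z. 0)" "f (- x) = (\<lambda>y z. - f x y z)" "f (x - x') = (\<lambda>y z. f x y z - f x' y z)"
    "f x (y + y') = (\<lambda>z. f x y z + f x y' z)" "f x (sB r y) = (\<lambda>z. sD r (f x y z))"
    "f x 0 = (\<lambda>z. 0)" "f x (- y) = (\<lambda>z. - f x y z)" "f x (y - y') = (\<lambda>z. f x y z - f x y' z)"
    "f x y (z + z') = f x y z + f x y z'" "f x y (sC r z) = sD r (f x y z)" "f x y 0 = 0"
    "f x y (- z) = - f x y z" "f x y (z - z') = f x y z - f x y z'"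
  using assms linearD[of sA sD "\<lambda>x. f x y z" for y z] linearD[of sB sD "\<lambda>y. f x y z" for z]
    linearD[of sC sD "\<lambda>z. f x y z"]
  unfolding trilin_def fun_eq_iff by auto

section \<open>Evaluation of tensors at forms\<close>

lemma tensor_space_induct [consumes 1, case_names zero tens add scale]:
  fixes sA :: "'k::field \<Rightarrow> 'a::ab_group_add \<Rightarrow> 'a" and sB :: "'k \<Rightarrow> 'b::ab_group_add \<Rightarrow> 'b"
  assumes "t \<in> tensor_space sA sB" "P 0" "\<And>a b. P (a \<otimes>\<^bsub>sA,sB\<^esub> b)"
    "\<And>t t'. P t \<Longrightarrow> P t' \<Longrightarrow> P (t + t')" "\<And>r t. P t \<Longrightarrow> P (fscale r t)"
  shows "P t"
proof -
  interpret vector_space "fscale :: 'k \<Rightarrow> ('a, 'b, 'k) tensor2 \<Rightarrow> _" by (rule vector_space_fscale)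
  have "t \<in> span {a \<otimes>\<^bsub>sA,sB\<^esub> b | a b. True}" using assms(1) unfolding tensor_space_def .
  then show ?thesis by (induction rule: span_induct_alt) (use assms(2-) in blast)+
qed

text \<open>The type \<open>tensor2\<close> contains arbitrary functionals. Pure tensors vanish off
  the bilinear forms and are linear on them, and linear combinations inherit both properties. The
  bilinearity premises matter: two functions that are not bilinear, at which every tensor is zero,
  can have a bilinear sum.\<close>

lemma tensor_space_eval:
  fixes sA :: "'k::field \<Rightarrow> 'a::ab_group_add \<Rightarrow> 'a" and sB :: "'k \<Rightarrow> 'b::ab_group_add \<Rightarrow> 'b"
  assumes t: "t \<in> tensor_space sA sB"
  shows "\<not> bilin sA sB (*) f \<Longrightarrow> t f = 0"
    and "t (\<lambda>u v. 0) = 0"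
    and "bilin sA sB (*) f \<Longrightarrow> bilin sA sB (*) g \<Longrightarrow> t (\<lambda>u v. f u v + g u v) = t f + t g"
    and "bilin sA sB (*) f \<Longrightarrow> bilin sA sB (*) g \<Longrightarrow> t (\<lambda>u v. f u v - g u v) = t f - t g"
    and "bilin sA sB (*) f \<Longrightarrow> t (\<lambda>u v. - f u v) = - t f"
    and "bilin sA sB (*) f \<Longrightarrow> t (\<lambda>u v. r * f u v) = r * t f"
proof -
  show "\<not> bilin sA sB (*) f \<Longrightarrow> t f = 0"
    using t by (induction rule: tensor_space_induct) (auto simp: tens_def fscale_def)
  show zero: "t (\<lambda>u v. 0) = 0"
    using t by (induction rule: tensor_space_induct) (auto simp: tens_def fscale_def)
  have add: "t (\<lambda>u v. f u v + g u v) = t f + t g"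
    if "bilin sA sB (*) f" "bilin sA sB (*) g" for f g
  proof -
    from that have "bilin sA sB (*) (\<lambda>u v. f u v + g u v)" by (simp add: bilin_iff algebra_simps)
    with t that show ?thesis
      by (induction rule: tensor_space_induct) (auto simp: tens_def fscale_def algebra_simps)
  qed
  have bilin_scale: "bilin sA sB (*) (\<lambda>u v. r * f u v)" if "bilin sA sB (*) f" for r f
    using that by (simp add: bilin_iff algebra_simps)
  have scale: "t (\<lambda>u v. r * f u v) = r * t f" if "bilin sA sB (*) f" for r f
    using t that bilin_scale[OF that, of r]
    by (induction rule: tensor_space_induct) (auto simp: tens_def fscale_def algebra_simps)
  have minus: "t (\<lambda>u v. - f u v) = - t f" if "bilin sA sB (*) f" for f
    using scale[OF that, of "- 1"] by simp
  show "bilin sA sB (*) f \<Longrightarrow> bilin sA sB (*) g \<Longrightarrow> t (\<lambda>u v. f u v + g u v) = t f + t g"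
    "bilin sA sB (*) f \<Longrightarrow> t (\<lambda>u v. - f u v) = - t f"
    "bilin sA sB (*) f \<Longrightarrow> t (\<lambda>u v. r * f u v) = r * t f"
    by (fact add minus scale)+
  show "t (\<lambda>u v. f u v - g u v) = t f - t g" if "bilin sA sB (*) f" "bilin sA sB (*) g"
    using add[OF that(1) bilin_scale[OF that(2), of "- 1"]] minus[OF that(2)] by simp
qed

text \<open>Two tensors are both zero at a function that is not bilinear, so only bilinear forms
  have to be tested.\<close>

lemma tensor_space_eqI:
  assumes "t \<in> tensor_space sA sB" "t' \<in> tensor_space sA sB"
    and "\<And>f. bilin sA sB (*) f \<Longrightarrow> t f = t' f"
  shows "t = t'"
  using assms tensor_space_eval(1) by (metis ext)

text \<open>The map induced by \<open>F\<close> is linear in the tensor and sends pure tensors to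
  values of \<open>F\<close>, which lie in the target span. It places flips and embeddings of
  tensors back in a tensor space.\<close>

lemma sweedler_in_tensor_space:
  fixes sA :: "'k::field \<Rightarrow> 'a::ab_group_add \<Rightarrow> 'a" and sB :: "'k \<Rightarrow> 'b::ab_group_add \<Rightarrow> 'b"
    and sC :: "'k \<Rightarrow> 'c::ab_group_add \<Rightarrow> 'c" and sD :: "'k \<Rightarrow> 'd::ab_group_add \<Rightarrow> 'd"
  assumes t: "t \<in> tensor_space sA sB" and F: "bilin sA sB fscale F"
    and FC: "\<And>a b. F a b \<in> tensor_space sC sD"
  shows "sweedler t F \<in> tensor_space sC sD"
proof -
  interpret vector_space "fscale :: 'k \<Rightarrow> ('c, 'd, 'k) tensor2 \<Rightarrow> _" by (rule vector_space_fscale)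
  have S: "subspace (tensor_space sC sD)" unfolding tensor_space_def by (rule subspace_span)
  have "sweedler 0 F = 0" "sweedler (u + u') F = sweedler u F + sweedler u' F"
    "sweedler (fscale r u) F = fscale r (sweedler u F)" for r u u'
    by (auto simp: sweedler_def fscale_def)
  note lin = this
  from t show ?thesis
    by (induction t rule: tensor_space_induct)
      (use subspace_0[OF S] subspace_add[OF S] subspace_scale[OF S] in
        \<open>simp_all only: lin sweedler_tens[OF F] FC\<close>)
qed

lemma linear_to_tensorD:
  fixes sV :: "'k::field \<Rightarrow> 'v::ab_group_add \<Rightarrow> 'v"
  assumes "linear_to_tensor sV sA sB d"
  shows "d x \<in> tensor_space sA sB" "d (x + y) f = d x f + d y f" "d (sV r x) f = r * d x f"
    "d 0 f = 0" "d (- x) f = - d x f" "d (x - y) f = d x f - d y f"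
proof -
  show "d x \<in> tensor_space sA sB" using assms unfolding linear_to_tensor_def by blast
  have "Vector_Spaces.linear sV fscale d" using assms unfolding linear_to_tensor_def by blast
  note l = linearD[OF this]
  show "d (x + y) f = d x f + d y f" "d (sV r x) f = r * d x f"
    "d 0 f = 0" "d (- x) f = - d x f" "d (x - y) f = d x f - d y f"
    unfolding l by (auto simp: fscale_def)
qed

section \<open>Permuted forms and iterated coproducts\<close>

lemma bilin_swap: "bilin sB sA (*) (\<lambda>u v. f v u) \<longleftrightarrow> bilin sA sB (*) f"
  by (auto simp: bilin_def)

text \<open>An iterated coproduct feeds the value of an inner functional to an outer one. That value
  is linear in \<open>u\<close> because tensors are linear on forms, and linear in \<open>v\<close>
  because \<open>d\<close> is linear; hence it is again a form, at which the outer functional can be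
  evaluated.\<close>

lemma bilin_iterate_right:
  assumes d: "linear_to_tensor sV sB sC d" and F: "trilin sA sB sC (*) F"
    and \<alpha>: "Vector_Spaces.linear sU sA \<alpha>"
  shows "bilin sU sV (*) (\<lambda>u v. d v (\<lambda>p q. F (\<alpha> u) p q))"
proof -
  have "bilin sB sC (*) (F w)" for w using F unfolding trilin_def bilin_def by blast
  moreover have "vector_space sU" "vector_space sV"
    using d \<alpha> unfolding linear_to_tensor_def linear_iff' by auto
  ultimately show ?thesis
    unfolding bilin_iff[of sU sV] linearD[OF \<alpha>] trilinD[OF F]
    using linear_to_tensorD[OF d] tensor_space_eval[OF linear_to_tensorD(1)[OF d]] by simp
qed

text \<open>A cyclic permutation of the arguments of \<open>F\<close>, followed by an exchange of
  \<open>u\<close> and \<open>v\<close>, reduces this to the case where the inner map sits on the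
  second factor.\<close>

lemma bilin_iterate_left:
  assumes d: "linear_to_tensor sV sA sB d" and F: "trilin sA sB sC (*) F"
    and \<alpha>: "Vector_Spaces.linear sU sC \<alpha>"
  shows "bilin sV sU (*) (\<lambda>u v. d u (\<lambda>p q. F p q (\<alpha> v)))"
proof -
  have "trilin sC sA sB (*) (\<lambda>w p q. F p q w)" using F by (auto simp: trilin_def)
  from bilin_iterate_right[OF d this \<alpha>] show ?thesis by (rule bilin_swap[THEN iffD2])
qed

lemma brL_eval:
  assumes "bilin s s (*) f"
  shows "brL s br \<alpha> z t f = t (\<lambda>u v. f (br z u) (\<alpha> v) + f (\<alpha> u) (br z v))"
  using assms by (simp add: brL_def sweedler_def tens_def)

lemma brR_eval:
  assumes "bilin s s (*) f"
  shows "brR s br \<alpha> t z f = t (\<lambda>u v. f (br u z) (\<alpha> v) + f (\<alpha> u) (br v z))"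
  using assms by (simp add: brR_def sweedler_def tens_def)

lemma trilin_swap12: "trilin sB sA sC (*) (\<lambda>u v w. f v u w) \<longleftrightarrow> trilin sA sB sC (*) f"
  by (auto simp: trilin_def)

lemma trilin_swap23: "trilin sA sC sB (*) (\<lambda>u v w. f u w v) \<longleftrightarrow> trilin sA sB sC (*) f"
  by (auto simp: trilin_def)

section \<open>Forms on a direct sum\<close>

lemma bilin_prodE:
  fixes sA :: "'k::field \<Rightarrow> 'a::ab_group_add \<Rightarrow> 'a" and sH :: "'k \<Rightarrow> 'h::ab_group_add \<Rightarrow> 'h"
  assumes F: "bilin (module_prod.scale sA sH) (module_prod.scale sA sH) (*) F"
    and vs: "vector_space sA" "vector_space sH"
  obtains f_aa f_ah f_ha f_hh where
    "bilin sA sA (*) f_aa" "bilin sA sH (*) f_ah" "bilin sH sA (*) f_ha" "bilin sH sH (*) f_hh"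
    "\<And>a x b y. F (a, x) (b, y) = f_aa a b + f_ah a y + f_ha x b + f_hh x y"
proof (rule that)
  interpret A: vector_space sA by fact
  interpret H: vector_space sH by fact
  interpret vector_space_prod sA sH ..
  \<comment> \<open>Linearity of the two embeddings into the direct sum, in the shape in which the
    bilinearity of \<open>F\<close> passes to its restrictions.\<close>
  have split: "(p + q, 0::'h) = (p, 0) + (q, 0)" "(0::'a, x + y) = (0, x) + (0, y)"
    "(sA r p, 0::'h) = scale r (p, 0)" "(0::'a, sH r x) = scale r (0, x)" for p q x y r
    by (auto simp: scale_prod)
  show "bilin sA sA (*) (\<lambda>a b. F (a, 0) (b, 0))" "bilin sA sH (*) (\<lambda>a y. F (a, 0) (0, y))"
    "bilin sH sA (*) (\<lambda>x b. F (0, x) (b, 0))" "bilin sH sH (*) (\<lambda>x y. F (0, x) (0, y))"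
    unfolding bilin_iff split bilinD[OF F] using vs by auto
  show "F (a, x) (b, y) = F (a, 0) (b, 0) + F (a, 0) (0, y) + F (0, x) (b, 0) + F (0, x) (0, y)"
    for a x b y
    using bilinD(1)[OF F, of "(a, 0)" "(0, x)" "(b, y)"]
      bilinD(6)[OF F, of "(a, 0)" "(b, 0)" "(0, y)"] bilinD(6)[OF F, of "(0, x)" "(b, 0)" "(0, y)"]
    by simp
qed

text \<open>With three of the four blocks equal to zero, this supplies the test forms that isolate
  one block of an identity on E.\<close>

lemma bilin_prodI:
  fixes sA :: "'k::field \<Rightarrow> 'a::ab_group_add \<Rightarrow> 'a" and sH :: "'k \<Rightarrow> 'h::ab_group_add \<Rightarrow> 'h"
  assumes f: "bilin sA sA (*) f_aa" "bilin sA sH (*) f_ah" "bilin sH sA (*) f_ha"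
    "bilin sH sH (*) f_hh"
    and F: "\<And>a x b y. F (a, x) (b, y) = f_aa a b + f_ah a y + f_ha x b + f_hh x y"
  shows "bilin (module_prod.scale sA sH) (module_prod.scale sA sH) (*) F"
proof -
  have vs: "vector_space sA" "vector_space sH" using f unfolding bilin_iff by auto
  interpret A: vector_space sA by fact
  interpret H: vector_space sH by fact
  interpret vector_space_prod sA sH ..
  show ?thesis
    unfolding bilin_iff using p.vector_space_axioms
    by (simp add: split_paired_all F scale_prod bilinD[OF f(1)] bilinD[OF f(2)] bilinD[OF f(3)]
        bilinD[OF f(4)] algebra_simps)
qed

lemma trilin_prodE:
  fixes sA :: "'k::field \<Rightarrow> 'a::ab_group_add \<Rightarrow> 'a" and sH :: "'k \<Rightarrow> 'h::ab_group_add \<Rightarrow> 'h"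
  assumes F: "trilin (module_prod.scale sA sH) (module_prod.scale sA sH) (module_prod.scale sA sH) (*) F"
    and vs: "vector_space sA" "vector_space sH"
  obtains f_aaa f_aah f_aha f_ahh f_haa f_hah f_hha f_hhh where
    "trilin sA sA sA (*) f_aaa" "trilin sA sA sH (*) f_aah" "trilin sA sH sA (*) f_aha"
    "trilin sA sH sH (*) f_ahh" "trilin sH sA sA (*) f_haa" "trilin sH sA sH (*) f_hah"
    "trilin sH sH sA (*) f_hha" "trilin sH sH sH (*) f_hhh"
    "\<And>a x b y c z. F (a, x) (b, y) (c, z) = f_aaa a b c + f_aah a b z + f_aha a y c + f_ahh a y z
      + f_haa x b c + f_hah x b z + f_hha x y c + f_hhh x y z"
proof (rule that)
  interpret A: vector_space sA by fact
  interpret H: vector_space sH by fact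
  interpret vector_space_prod sA sH ..
  have split: "(p + q, 0::'h) = (p, 0) + (q, 0)" "(0::'a, x + y) = (0, x) + (0, y)"
    "(sA r p, 0::'h) = scale r (p, 0)" "(0::'a, sH r x) = scale r (0, x)" for p q x y r
    by (auto simp: scale_prod)
  show "trilin sA sA sA (*) (\<lambda>a b c. F (a, 0) (b, 0) (c, 0))"
    "trilin sA sA sH (*) (\<lambda>a b z. F (a, 0) (b, 0) (0, z))"
    "trilin sA sH sA (*) (\<lambda>a y c. F (a, 0) (0, y) (c, 0))"
    "trilin sA sH sH (*) (\<lambda>a y z. F (a, 0) (0, y) (0, z))"
    "trilin sH sA sA (*) (\<lambda>x b c. F (0, x) (b, 0) (c, 0))"
    "trilin sH sA sH (*) (\<lambda>x b z. F (0, x) (b, 0) (0, z))"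
    "trilin sH sH sA (*) (\<lambda>x y c. F (0, x) (0, y) (c, 0))"
    "trilin sH sH sH (*) (\<lambda>x y z. F (0, x) (0, y) (0, z))"
    unfolding trilin_iff split trilinD[OF F] using vs by auto
  have pair: "(a, x) = (a, 0) + (0, x)" for a :: 'a and x :: 'h by simp
  show "F (a, x) (b, y) (c, z) =
      F (a, 0) (b, 0) (c, 0) + F (a, 0) (b, 0) (0, z) + F (a, 0) (0, y) (c, 0) +
      F (a, 0) (0, y) (0, z) + F (0, x) (b, 0) (c, 0) + F (0, x) (b, 0) (0, z) +
      F (0, x) (0, y) (c, 0) + F (0, x) (0, y) (0, z)" for a x b y c z
    unfolding pair[of a x] pair[of b y] pair[of c z] trilinD[OF F] by (simp only: ac_simps)
qed

section \<open>The double biproduct\<close>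

text \<open>The standing hypotheses: both matched pairs, but no condition linking brackets and
  actions to cobrackets and coactions. BB5 to BB10 and YDB are left out because they are what is to
  be characterised.\<close>

locale biproduct =
  matched_pair_hom_lie_algebras sA brA \<alpha>A sH brH \<alpha>H act ract +
  matched_pair_hom_lie_coalgebras sA \<delta>A \<alpha>A sH \<delta>H \<alpha>H \<phi> \<psi>
  for sA :: "'k::field \<Rightarrow> 'a::ab_group_add \<Rightarrow> 'a" and brA \<delta>A \<alpha>A
    and sH :: "'k \<Rightarrow> 'h::ab_group_add \<Rightarrow> 'h" and brH \<delta>H \<alpha>H
    and act :: "'h \<Rightarrow> 'a \<Rightarrow> 'a"  (infixr "\<triangleright>" 75)
    and ract :: "'h \<Rightarrow> 'a \<Rightarrow> 'h"  (infixl "\<triangleleft>" 75)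
    and \<phi> \<psi>
begin

sublocale E: vector_space_prod sA sH ..

abbreviation sE where "sE \<equiv> module_prod.scale sA sH"
abbreviation brE where "brE \<equiv> biproduct_bracket brA brH act ract"
abbreviation \<delta>E where "\<delta>E \<equiv> biproduct_cobracket sA sH \<delta>A \<delta>H \<phi> \<psi>"
abbreviation \<alpha>E where "\<alpha>E \<equiv> map_prod \<alpha>A \<alpha>H"

lemmas additive =
  bilinD[OF A.bilin_bracket] bilinD[OF H.bilin_bracket] bilinD[OF A_mod.bilin_act]
  bilinD[OF H_mod.bilin_ract] linearD[OF A.linear_\<alpha>] linearD[OF H.linear_\<alpha>]
  linear_to_tensorD(2-)[OF A.linear_\<delta>] linear_to_tensorD(2-)[OF H.linear_\<delta>]
  linear_to_tensorD(2-)[OF A_comod.linear_\<phi>] linear_to_tensorD(2-)[OF H_comod.linear_\<psi>]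

lemmas tensors =
  linear_to_tensorD(1)[OF A.linear_\<delta>] linear_to_tensorD(1)[OF H.linear_\<delta>]
  linear_to_tensorD(1)[OF A_comod.linear_\<phi>] linear_to_tensorD(1)[OF H_comod.linear_\<psi>]

lemmas evals =
  tensor_space_eval(2-)[OF tensors(1)] tensor_space_eval(2-)[OF tensors(2)]
  tensor_space_eval(2-)[OF tensors(3)] tensor_space_eval(2-)[OF tensors(4)]

lemmas spaces = A.vector_space_axioms H.vector_space_axioms E.p.vector_space_axioms

lemma coskew_A: "bilin sA sA (*) f \<Longrightarrow> \<delta>A a (\<lambda>u v. f v u) = - \<delta>A a f"
  using fun_cong[OF A.coskew, of a f] by (simp add: tau_def sweedler_def tens_def)

lemma coskew_H: "bilin sH sH (*) f \<Longrightarrow> \<delta>H x (\<lambda>u v. f v u) = - \<delta>H x f"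
  using fun_cong[OF H.coskew, of x f] by (simp add: tau_def sweedler_def tens_def)

section \<open>The cobracket of E\<close>

text \<open>Embedding a tensor into E amounts to restricting the test form, and \<open>tau\<close>
  transposes the restriction. The blocks of \<open>F\<close> enter because the flip carries its own
  bilinearity test in \<open>tens\<close>, which the restriction of \<open>F\<close> to A x H has to
  pass.\<close>

lemma cobracket_eval:
  assumes F: "bilin sE sE (*) F"
  shows "\<delta>E (a, x) F =
    \<delta>A a (\<lambda>u v. F (u, 0) (v, 0)) + \<phi> a (\<lambda>u v. F (0, u) (v, 0)) - \<phi> a (\<lambda>u v. F (v, 0) (0, u)) +
    (\<delta>H x (\<lambda>u v. F (0, u) (0, v)) + \<psi> x (\<lambda>u v. F (0, u) (v, 0)) - \<psi> x (\<lambda>u v. F (v, 0) (0, u)))"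
proof -
  obtain f_aa f_ah f_ha f_hh where
    f: "bilin sA sA (*) f_aa" "bilin sA sH (*) f_ah" "bilin sH sA (*) f_ha" "bilin sH sH (*) f_hh"
      "\<And>a x b y. F (a, x) (b, y) = f_aa a b + f_ah a y + f_ha x b + f_hh x y"
    using bilin_prodE[OF F spaces(1,2)] by blast
  show ?thesis using F
    by (simp add: biproduct_cobracket_def Let_def tau_def sweedler_def tens_def f bilinD[OF f(1)]
        bilinD[OF f(2)] bilinD[OF f(3)] bilinD[OF f(4)])
qed

text \<open>This makes the evaluation rules for tensors available for \<open>\<delta>E\<close>
  itself, and hence for iterated cobrackets of E.\<close>

lemma linear_cobracket: "linear_to_tensor sE sE sE \<delta>E"
proof -
  interpret T: vector_space "fscale :: 'k \<Rightarrow> ('a \<times> 'h, 'a \<times> 'h, 'k) tensor2 \<Rightarrow> _"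
    by (rule vector_space_fscale)
  have sub: "T.subspace (tensor_space sE sE)"
    unfolding tensor_space_def by (rule T.subspace_span)
  have tens: "X \<otimes>\<^bsub>sE,sE\<^esub> Y \<in> tensor_space sE sE" for X Y
    unfolding tensor_space_def by (rule T.span_base) blast
  note bt = bilinD[OF bilin_tens[OF spaces(3,3)]]
  have split: "(p + q, 0::'h) = (p, 0) + (q, 0)" "(0::'a, x + y) = (0, x) + (0, y)"
    "(sA r p, 0::'h) = sE r (p, 0)" "(0::'a, sH r x) = sE r (0, x)" for p q x y r
    by (auto simp: E.scale_prod)
  have emb: "bilin sA sA fscale (\<lambda>a b. (a, 0) \<otimes>\<^bsub>sE,sE\<^esub> (b, 0))"
    "bilin sH sA fscale (\<lambda>x b. (0, x) \<otimes>\<^bsub>sE,sE\<^esub> (b, 0))"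
    "bilin sA sH fscale (\<lambda>a y. (a, 0) \<otimes>\<^bsub>sE,sE\<^esub> (0, y))"
    "bilin sH sH fscale (\<lambda>x y. (0, x) \<otimes>\<^bsub>sE,sE\<^esub> (0, y))"
    unfolding bilin_def linear_iff' split bt using spaces T.vector_space_axioms by auto
  \<comment> \<open>\<open>tau\<close> is defined on all functionals, so it has to be checked that
    it maps tensors to tensors.\<close>
  have tau: "tau sH sA t \<in> tensor_space sA sH" if "t \<in> tensor_space sH sA" for t
    unfolding tau_def
  proof (rule sweedler_in_tensor_space[OF that])
    show "bilin sH sA fscale (\<lambda>x y. y \<otimes>\<^bsub>sA,sH\<^esub> x)"
      using bilin_tens[OF spaces(1,2)] by (auto simp: bilin_def)
    show "b \<otimes>\<^bsub>sA,sH\<^esub> a \<in> tensor_space sA sH" for a b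
      unfolding tensor_space_def
      by (rule module.span_base) (use vector_space_fscale in \<open>auto simp: module_iff_vector_space\<close>)
  qed
  have mem: "\<delta>E (a, x) \<in> tensor_space sE sE" for a x
    unfolding biproduct_cobracket_def Let_def prod.case
    by (intro T.subspace_add[OF sub] T.subspace_diff[OF sub]
        sweedler_in_tensor_space[OF _ emb(1)] sweedler_in_tensor_space[OF _ emb(2)]
        sweedler_in_tensor_space[OF _ emb(3)] sweedler_in_tensor_space[OF _ emb(4)] tens tensors tau)
  \<comment> \<open>Both sides are tensors, so they need comparing only at forms, where the block
    formula is additive in the argument.\<close>
  have "\<delta>E (X + Y) = \<delta>E X + \<delta>E Y" for X Y
    by (cases X; cases Y; rule tensor_space_eqI[of _ sE sE])
      (simp_all add: mem T.subspace_add[OF sub] cobracket_eval additive)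
  moreover have "\<delta>E (sE r X) = fscale r (\<delta>E X)" for r X
    by (cases X; rule tensor_space_eqI[of _ sE sE])
      (simp_all add: mem T.subspace_scale[OF sub] E.scale_prod cobracket_eval additive,
        simp add: fscale_def cobracket_eval algebra_simps)
  ultimately show ?thesis
    using mem spaces T.vector_space_axioms unfolding linear_to_tensor_def linear_iff' by auto
qed

section \<open>The Hom-Lie algebra structure on E\<close>

lemma hom_lie_algebra_biproduct: "hom_lie_algebra sE brE \<alpha>E"
proof (intro hom_lie_algebra.intro hom_lie_algebra_axioms.intro spaces)
  show "Vector_Spaces.linear sE sE \<alpha>E"
    unfolding linear_iff' using spaces by (auto simp: E.scale_prod additive)
  show "bilin sE sE sE brE"
    unfolding bilin_def linear_iff' using spaces
    by (auto simp: E.scale_prod biproduct_bracket_def additive algebra_simps)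
  show "brE X Y = - brE Y X" for X Y
    using A.skew[of "fst X" "fst Y"] H.skew[of "snd X" "snd Y"]
    by (cases X; cases Y) (simp add: biproduct_bracket_def)
  show "brE (\<alpha>E X) (brE Y Z) + brE (\<alpha>E Y) (brE Z X) + brE (\<alpha>E Z) (brE X Y) = 0" for X Y Z
  proof -
    obtain a x b y c z where [simp]: "X = (a, x)" "Y = (b, y)" "Z = (c, z)" by (metis prod.exhaust)
    \<comment> \<open>In the A-component the Jacobi identity of A removes the pure brackets, and the
      left module law and BB1 remove the mixed terms; in the H-component the right module law and
      BB2 do so. The instances of antisymmetry put the twisted vector first in every
      bracket.\<close>
    show ?thesis
      using A.hom_jacobi[of a b c] H.hom_jacobi[of x y z]
      by (simp add: biproduct_bracket_def additive A_mod.left_module H_mod.right_module BB1 BB2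
          A.skew[of _ "\<alpha>A _"] H.skew[of _ "\<alpha>H _"] prod_eq_iff)
  qed
qed

section \<open>Coalgebra and comodule axioms tested on forms\<close>

text \<open>Applying the tensor identity to a form nests the inner functional inside the outer one,
  and \<open>tau12\<close> becomes an exchange of the first two arguments of the form. The comodule
  axioms, BB3 and BB4 are translated in the same way.\<close>

lemma cojacobi_A_eval:
  assumes f: "trilin sA sA sA (*) f"
  shows "\<delta>A a (\<lambda>u v. \<delta>A v (\<lambda>p q. f (\<alpha>A u) p q)) =
    \<delta>A a (\<lambda>u v. \<delta>A u (\<lambda>p q. f p q (\<alpha>A v))) + \<delta>A a (\<lambda>u v. \<delta>A v (\<lambda>p q. f p (\<alpha>A u) q))"
  using fun_cong[OF A.hom_cojacobi, of a f] f trilin_swap12[THEN iffD2, OF f]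
  by (simp add: tensL_def tensR_def tau12_def sweedler_def sweedler3_def tens3_def)

lemma cojacobi_H_eval:
  assumes f: "trilin sH sH sH (*) f"
  shows "\<delta>H x (\<lambda>u v. \<delta>H v (\<lambda>p q. f (\<alpha>H u) p q)) =
    \<delta>H x (\<lambda>u v. \<delta>H u (\<lambda>p q. f p q (\<alpha>H v))) + \<delta>H x (\<lambda>u v. \<delta>H v (\<lambda>p q. f p (\<alpha>H u) q))"
  using fun_cong[OF H.hom_cojacobi, of x f] f trilin_swap12[THEN iffD2, OF f]
  by (simp add: tensL_def tensR_def tau12_def sweedler_def sweedler3_def tens3_def)

lemma left_comodule_eval:
  assumes f: "trilin sH sH sA (*) f"
  shows "\<phi> a (\<lambda>u v. \<delta>H u (\<lambda>p q. f p q (\<alpha>A v))) =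
    \<phi> a (\<lambda>u v. \<phi> v (\<lambda>p q. f (\<alpha>H u) p q)) - \<phi> a (\<lambda>u v. \<phi> v (\<lambda>p q. f p (\<alpha>H u) q))"
  using fun_cong[OF A_comod.left_comodule, of a f] f trilin_swap12[THEN iffD2, OF f]
  by (simp add: tensL_def tensR_def tau12_def sweedler_def sweedler3_def tens3_def)

lemma right_comodule_eval:
  assumes f: "trilin sH sA sA (*) f"
  shows "\<psi> x (\<lambda>u v. \<delta>A v (\<lambda>p q. f (\<alpha>H u) p q)) =
    \<psi> x (\<lambda>u v. \<psi> u (\<lambda>p q. f p q (\<alpha>A v))) - \<psi> x (\<lambda>u v. \<psi> u (\<lambda>p q. f p (\<alpha>A v) q))"
  using fun_cong[OF H_comod.right_comodule, of x f] f trilin_swap23[THEN iffD2, OF f]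
  by (simp add: tensL_def tensR_def tau23_def sweedler_def sweedler3_def tens3_def)

lemma BB3_eval:
  assumes f: "trilin sH sA sA (*) f"
  shows "\<phi> a (\<lambda>u v. \<delta>A v (\<lambda>p q. f (\<alpha>H u) p q)) =
    \<delta>A a (\<lambda>u v. \<phi> u (\<lambda>p q. f p q (\<alpha>A v))) + \<delta>A a (\<lambda>u v. \<phi> v (\<lambda>p q. f p (\<alpha>A u) q)) +
    \<phi> a (\<lambda>u v. \<psi> u (\<lambda>p q. f p q (\<alpha>A v))) - \<phi> a (\<lambda>u v. \<psi> u (\<lambda>p q. f p (\<alpha>A v) q))"
  using fun_cong[OF BB3, of a f] f trilin_swap12[THEN iffD2, OF f] trilin_swap23[THEN iffD2, OF f]
  by (simp add: tensL_def tensR_def tau12_def tau23_def sweedler_def sweedler3_def tens3_def)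

lemma BB4_eval:
  assumes f: "trilin sH sH sA (*) f"
  shows "\<psi> x (\<lambda>u v. \<delta>H u (\<lambda>p q. f p q (\<alpha>A v))) =
    \<delta>H x (\<lambda>u v. \<psi> v (\<lambda>p q. f (\<alpha>H u) p q)) + \<delta>H x (\<lambda>u v. \<psi> u (\<lambda>p q. f p (\<alpha>H v) q)) +
    \<psi> x (\<lambda>u v. \<phi> v (\<lambda>p q. f (\<alpha>H u) p q)) - \<psi> x (\<lambda>u v. \<phi> v (\<lambda>p q. f p (\<alpha>H u) q))"
  using fun_cong[OF BB4, of x f] f trilin_swap12[THEN iffD2, OF f] trilin_swap23[THEN iffD2, OF f]
  by (simp add: tensL_def tensR_def tau12_def tau23_def sweedler_def sweedler3_def tens3_def)

text \<open>In the expanded co-Jacobi identity of E the coaction may sit on either leg of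
  \<open>\<delta>A\<close>. Coskewness moves it to the second leg, so that equal terms become
  recognisable; its counterpart for H does the same.\<close>

lemma coskew_A_iterate:
  assumes f: "trilin sH sA sA (*) f"
  shows "\<delta>A a (\<lambda>u v. \<phi> u (\<lambda>p q. f p q (\<alpha>A v))) = - \<delta>A a (\<lambda>u v. \<phi> v (\<lambda>p q. f p q (\<alpha>A u)))"
  using coskew_A[OF bilin_iterate_left[OF A_comod.linear_\<phi> f A.linear_\<alpha>], of a] by simp

lemma coskew_H_iterate:
  assumes f: "trilin sH sH sA (*) f"
  shows "\<delta>H x (\<lambda>u v. \<psi> u (\<lambda>p q. f p (\<alpha>H v) q)) = - \<delta>H x (\<lambda>u v. \<psi> v (\<lambda>p q. f p (\<alpha>H u) q))"
  using coskew_H[OF bilin_iterate_left[OF H_comod.linear_\<psi> trilin_swap23[THEN iffD2, OF f] H.linear_\<alpha>], of x]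
  by simp

section \<open>The Hom-Lie coalgebra structure on E\<close>

lemma hom_lie_coalgebra_biproduct: "hom_lie_coalgebra sE \<delta>E \<alpha>E"
proof (intro hom_lie_coalgebra.intro hom_lie_coalgebra_axioms.intro spaces linear_cobracket)
  note eE = tensor_space_eval[OF linear_to_tensorD(1)[OF linear_cobracket]]
  show lin: "Vector_Spaces.linear sE sE \<alpha>E"
    using hom_lie_algebra_biproduct by (rule hom_lie_algebra.linear_\<alpha>)
  show "\<delta>E X = - tau sE sE (\<delta>E X)" for X
  proof
    fix F :: "'a \<times> 'h \<Rightarrow> 'a \<times> 'h \<Rightarrow> 'k"
    show "\<delta>E X F = (- tau sE sE (\<delta>E X)) F"
    proof (cases "bilin sE sE (*) F")
      \<comment> \<open>Equality of functionals concerns every function \<open>F\<close>; at those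
        that are not bilinear both sides are zero.\<close>
      case False
      then show ?thesis by (simp add: tau_def sweedler_def tens_def eE)
    next
      case F: True
      obtain a x where X: "X = (a, x)" by (metis prod.exhaust)
      obtain f_aa f_ah f_ha f_hh where
        f: "bilin sA sA (*) f_aa" "bilin sA sH (*) f_ah" "bilin sH sA (*) f_ha" "bilin sH sH (*) f_hh"
        and F_eq: "\<And>a x b y. F (a, x) (b, y) = f_aa a b + f_ah a y + f_ha x b + f_hh x y"
        using bilin_prodE[OF F spaces(1,2)] by blast
      show ?thesis
        using F by (simp add: X tau_def sweedler_def tens_def cobracket_eval[OF F]
            cobracket_eval[OF bilin_swap[THEN iffD2, OF F]] F_eq bilinD[OF f(1)] bilinD[OF f(2)]
            bilinD[OF f(3)] bilinD[OF f(4)] coskew_A[OF f(1)] coskew_H[OF f(4)])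
    qed
  qed
  show "sweedler (\<delta>E X) (\<lambda>x1 x2. tensL sE sE sE (\<alpha>E x1) (\<delta>E x2)) =
      sweedler (\<delta>E X) (\<lambda>x1 x2. tensR sE sE sE (\<delta>E x1) (\<alpha>E x2)) +
      tau12 sE sE sE (sweedler (\<delta>E X) (\<lambda>x1 x2. tensL sE sE sE (\<alpha>E x1) (\<delta>E x2)))" for X
  proof
    fix F :: "'a \<times> 'h \<Rightarrow> 'a \<times> 'h \<Rightarrow> 'a \<times> 'h \<Rightarrow> 'k"
    let ?L = "sweedler (\<delta>E X) (\<lambda>x1 x2. tensL sE sE sE (\<alpha>E x1) (\<delta>E x2))"
    let ?R = "sweedler (\<delta>E X) (\<lambda>x1 x2. tensR sE sE sE (\<delta>E x1) (\<alpha>E x2)) + tau12 sE sE sE ?L"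
    show "?L F = ?R F"
    proof (cases "trilin sE sE sE (*) F")
      case False
      moreover from this have "\<not> trilin sE sE sE (*) (\<lambda>u v w. F v u w)"
        using trilin_swap12[of sE sE sE F] by blast
      ultimately show ?thesis
        by (simp add: tensL_def tensR_def tau12_def sweedler_def sweedler3_def tens3_def eE cong: if_cong)
    next
      case F: True
      obtain a x where X: "X = (a, x)" by (metis prod.exhaust)
      obtain f_aaa f_aah f_aha f_ahh f_haa f_hah f_hha f_hhh where
        f: "trilin sA sA sA (*) f_aaa" "trilin sA sA sH (*) f_aah" "trilin sA sH sA (*) f_aha"
          "trilin sA sH sH (*) f_ahh" "trilin sH sA sA (*) f_haa" "trilin sH sA sH (*) f_hah"
          "trilin sH sH sA (*) f_hha" "trilin sH sH sH (*) f_hhh"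
        and F_eq: "\<And>a x b y c z. F (a, x) (b, y) (c, z) =
          f_aaa a b c + f_aah a b z + f_aha a y c + f_ahh a y z
          + f_haa x b c + f_hah x b z + f_hha x y c + f_hhh x y z"
        using trilin_prodE[OF F spaces(1,2)] by blast
      note fD = trilinD[OF f(1)] trilinD[OF f(2)] trilinD[OF f(3)] trilinD[OF f(4)]
        trilinD[OF f(5)] trilinD[OF f(6)] trilinD[OF f(7)] trilinD[OF f(8)]
      note F12 = trilin_swap12[THEN iffD2, OF F]
      have bF: "bilin sE sE (*) (F w)" "bilin sE sE (*) (\<lambda>p q. F p q w)"
        "bilin sE sE (*) (\<lambda>p q. F p w q)" for w
        using F unfolding trilin_def bilin_def by blast+
      \<comment> \<open>The outer cobracket is applied to a form containing the inner one; the block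
        formula applies once that form is known to be bilinear.\<close>
      note ev = bF[THEN cobracket_eval]
        cobracket_eval[OF bilin_iterate_right[OF linear_cobracket F lin]]
        cobracket_eval[OF bilin_iterate_right[OF linear_cobracket F12 lin]]
        cobracket_eval[OF bilin_iterate_left[OF linear_cobracket F lin]]
      have L: "?L F = \<delta>E X (\<lambda>u v. \<delta>E v (\<lambda>p q. F (\<alpha>E u) p q))"
        using F by (simp add: tensL_def sweedler_def tens3_def)
      have R: "?R F = \<delta>E X (\<lambda>u v. \<delta>E u (\<lambda>p q. F p q (\<alpha>E v))) + \<delta>E X (\<lambda>u v. \<delta>E v (\<lambda>p q. F p (\<alpha>E u) q))"
        using F F12 by (simp add: tensL_def tensR_def tau12_def sweedler_def sweedler3_def tens3_def)
      \<comment> \<open>The comodule axioms, BB3 and BB4 expect the arguments from H before those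
        from A, so the other mixed blocks are permuted into this order.\<close>
      have haa: "trilin sH sA sA (*) (\<lambda>p q w. f_aha q p w)" "trilin sH sA sA (*) (\<lambda>p q w. f_aah q w p)"
        using f(2,3) unfolding trilin_def by blast+
      have hha: "trilin sH sH sA (*) (\<lambda>p q w. f_hah p w q)" "trilin sH sH sA (*) (\<lambda>p q w. f_ahh w p q)"
        using f(4,6) unfolding trilin_def by blast+
      \<comment> \<open>The two pure blocks use the co-Jacobi identities of A and H. The three
        blocks with two arguments in H use the left comodule axiom and BB4, the three with two
        arguments in A the right comodule axiom and BB3.\<close>
      note comult = cojacobi_A_eval[OF f(1)] cojacobi_H_eval[OF f(8)]
        f(7)[THEN left_comodule_eval] hha[THEN left_comodule_eval]
        f(7)[THEN BB4_eval] hha[THEN BB4_eval]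
        f(7)[THEN coskew_H_iterate] hha[THEN coskew_H_iterate]
        f(5)[THEN right_comodule_eval] haa[THEN right_comodule_eval]
        f(5)[THEN BB3_eval] haa[THEN BB3_eval]
        f(5)[THEN coskew_A_iterate] haa[THEN coskew_A_iterate]
      show ?thesis
        unfolding L R unfolding X
        by (simp add: ev F_eq fD additive evals bilin_iff spaces algebra_simps comult)
    qed
  qed
qed

section \<open>Compatibility of bracket and cobracket\<close>

text \<open>Bracketing a tensor with a vector is moved onto the test form. The resulting
  \<open>G\<close> is again bilinear because bracket and structure map are linear, so the block
  formula for \<open>\<delta>E\<close> applies to it.\<close>

lemma compat_eval:
  assumes F: "bilin sE sE (*) F"
  shows "brL sE brE \<alpha>E (\<alpha>E X) (\<delta>E (b, y)) F =
      (let G = \<lambda>u v. F (brE (\<alpha>E X) u) (\<alpha>E v) + F (\<alpha>E u) (brE (\<alpha>E X) v) in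
        \<delta>A b (\<lambda>u v. G (u, 0) (v, 0)) + \<phi> b (\<lambda>u v. G (0, u) (v, 0)) - \<phi> b (\<lambda>u v. G (v, 0) (0, u)) +
        (\<delta>H y (\<lambda>u v. G (0, u) (0, v)) + \<psi> y (\<lambda>u v. G (0, u) (v, 0)) - \<psi> y (\<lambda>u v. G (v, 0) (0, u))))"
    and "brR sE brE \<alpha>E (\<delta>E (a, x)) (\<alpha>E Y) F =
      (let G = \<lambda>u v. F (brE u (\<alpha>E Y)) (\<alpha>E v) + F (\<alpha>E u) (brE v (\<alpha>E Y)) in
        \<delta>A a (\<lambda>u v. G (u, 0) (v, 0)) + \<phi> a (\<lambda>u v. G (0, u) (v, 0)) - \<phi> a (\<lambda>u v. G (v, 0) (0, u)) +
        (\<delta>H x (\<lambda>u v. G (0, u) (0, v)) + \<psi> x (\<lambda>u v. G (0, u) (v, 0)) - \<psi> x (\<lambda>u v. G (v, 0) (0, u))))"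
proof -
  interpret L: hom_lie_algebra sE brE \<alpha>E by (rule hom_lie_algebra_biproduct)
  have G: "bilin sE sE (*) (\<lambda>u v. F (brE Z u) (\<alpha>E v) + F (\<alpha>E u) (brE Z v))"
    "bilin sE sE (*) (\<lambda>u v. F (brE u Z) (\<alpha>E v) + F (\<alpha>E u) (brE v Z))" for Z
    by (simp_all add: bilin_iff spaces bilinD[OF F] bilinD[OF L.bilin_bracket] linearD[OF L.linear_\<alpha>]
        algebra_simps)
  show "brL sE brE \<alpha>E (\<alpha>E X) (\<delta>E (b, y)) F =
      (let G = \<lambda>u v. F (brE (\<alpha>E X) u) (\<alpha>E v) + F (\<alpha>E u) (brE (\<alpha>E X) v) in
        \<delta>A b (\<lambda>u v. G (u, 0) (v, 0)) + \<phi> b (\<lambda>u v. G (0, u) (v, 0)) - \<phi> b (\<lambda>u v. G (v, 0) (0, u)) +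
        (\<delta>H y (\<lambda>u v. G (0, u) (0, v)) + \<psi> y (\<lambda>u v. G (0, u) (v, 0)) - \<psi> y (\<lambda>u v. G (v, 0) (0, u))))"
    unfolding brL_eval[OF F] Let_def by (rule cobracket_eval[OF G(1)])
  show "brR sE brE \<alpha>E (\<delta>E (a, x)) (\<alpha>E Y) F =
      (let G = \<lambda>u v. F (brE u (\<alpha>E Y)) (\<alpha>E v) + F (\<alpha>E u) (brE v (\<alpha>E Y)) in
        \<delta>A a (\<lambda>u v. G (u, 0) (v, 0)) + \<phi> a (\<lambda>u v. G (0, u) (v, 0)) - \<phi> a (\<lambda>u v. G (v, 0) (0, u)) +
        (\<delta>H x (\<lambda>u v. G (0, u) (0, v)) + \<psi> x (\<lambda>u v. G (0, u) (v, 0)) - \<psi> x (\<lambda>u v. G (v, 0) (0, u))))"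
    unfolding brR_eval[OF F] Let_def by (rule cobracket_eval[OF G(2)])
qed

text \<open>BB5 and BB9, evaluated at a form on A; compat_HH is BB6 and BB10, compat_HA is BB7, BB8 and YDB.\<close>

definition compat_AA :: "('a \<Rightarrow> 'a \<Rightarrow> 'k) \<Rightarrow> bool" where
  "compat_AA f \<longleftrightarrow>
    (\<forall>x a. \<delta>A (x \<triangleright> a) f =
      \<delta>A a (\<lambda>u v. f (\<alpha>H x \<triangleright> u) (\<alpha>A v)) + \<delta>A a (\<lambda>u v. f (\<alpha>A u) (\<alpha>H x \<triangleright> v))
      + \<psi> x (\<lambda>u v. f (u \<triangleright> \<alpha>A a) (\<alpha>A v)) - \<psi> x (\<lambda>u v. f (\<alpha>A v) (u \<triangleright> \<alpha>A a))) \<and>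
    (\<forall>a b. \<delta>A (brA a b) f =
      \<delta>A b (\<lambda>u v. f (brA (\<alpha>A a) u) (\<alpha>A v) + f (\<alpha>A u) (brA (\<alpha>A a) v))
      + \<delta>A a (\<lambda>u v. f (brA u (\<alpha>A b)) (\<alpha>A v) + f (\<alpha>A u) (brA v (\<alpha>A b)))
      - \<phi> b (\<lambda>u v. f (u \<triangleright> \<alpha>A a) (\<alpha>A v)) - \<phi> a (\<lambda>u v. f (\<alpha>A v) (u \<triangleright> \<alpha>A b))
      + \<phi> a (\<lambda>u v. f (u \<triangleright> \<alpha>A b) (\<alpha>A v)) + \<phi> b (\<lambda>u v. f (\<alpha>A v) (u \<triangleright> \<alpha>A a)))"

definition compat_HH :: "('h \<Rightarrow> 'h \<Rightarrow> 'k) \<Rightarrow> bool" where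
  "compat_HH f \<longleftrightarrow>
    (\<forall>x a. \<delta>H (x \<triangleleft> a) f =
      \<delta>H x (\<lambda>u v. f (\<alpha>H u) (v \<triangleleft> \<alpha>A a)) + \<delta>H x (\<lambda>u v. f (u \<triangleleft> \<alpha>A a) (\<alpha>H v))
      + \<phi> a (\<lambda>u v. f (\<alpha>H u) (\<alpha>H x \<triangleleft> v)) - \<phi> a (\<lambda>u v. f (\<alpha>H x \<triangleleft> v) (\<alpha>H u))) \<and>
    (\<forall>x y. \<delta>H (brH x y) f =
      \<delta>H x (\<lambda>u v. f (brH u (\<alpha>H y)) (\<alpha>H v) + f (\<alpha>H u) (brH v (\<alpha>H y)))
      + \<delta>H y (\<lambda>u v. f (brH (\<alpha>H x) u) (\<alpha>H v) + f (\<alpha>H u) (brH (\<alpha>H x) v))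
      - \<psi> x (\<lambda>u v. f (\<alpha>H u) (\<alpha>H y \<triangleleft> v)) - \<psi> y (\<lambda>u v. f (\<alpha>H x \<triangleleft> v) (\<alpha>H u))
      + \<psi> y (\<lambda>u v. f (\<alpha>H u) (\<alpha>H x \<triangleleft> v)) + \<psi> x (\<lambda>u v. f (\<alpha>H y \<triangleleft> v) (\<alpha>H u)))"

definition compat_HA :: "('h \<Rightarrow> 'a \<Rightarrow> 'k) \<Rightarrow> bool" where
  "compat_HA f \<longleftrightarrow>
    (\<forall>a b. \<phi> (brA a b) f =
      \<phi> a (\<lambda>u v. f (\<alpha>H u) (brA v (\<alpha>A b))) + \<phi> b (\<lambda>u v. f (\<alpha>H u) (brA (\<alpha>A a) v))
      + \<phi> a (\<lambda>u v. f (u \<triangleleft> \<alpha>A b) (\<alpha>A v)) - \<phi> b (\<lambda>u v. f (u \<triangleleft> \<alpha>A a) (\<alpha>A v))) \<and>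
    (\<forall>x y. \<psi> (brH x y) f =
      \<psi> y (\<lambda>u v. f (brH (\<alpha>H x) u) (\<alpha>A v)) + \<psi> x (\<lambda>u v. f (brH u (\<alpha>H y)) (\<alpha>A v))
      + \<psi> y (\<lambda>u v. f (\<alpha>H u) (\<alpha>H x \<triangleright> v)) - \<psi> x (\<lambda>u v. f (\<alpha>H u) (\<alpha>H y \<triangleright> v))) \<and>
    (\<forall>x a. \<phi> (x \<triangleright> a) f + \<psi> (x \<triangleleft> a) f =
      \<phi> a (\<lambda>u v. f (brH (\<alpha>H x) u) (\<alpha>A v)) + \<phi> a (\<lambda>u v. f (\<alpha>H u) (\<alpha>H x \<triangleright> v))
      + \<delta>H x (\<lambda>u v. f (\<alpha>H u) (v \<triangleright> \<alpha>A a)) + \<psi> x (\<lambda>u v. f (\<alpha>H u) (brA v (\<alpha>A a)))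
      + \<psi> x (\<lambda>u v. f (u \<triangleleft> \<alpha>A a) (\<alpha>A v)) + \<delta>A a (\<lambda>u v. f (\<alpha>H x \<triangleleft> u) (\<alpha>A v)))"

text \<open>Each of the seven conditions equates two functionals that vanish off the bilinear forms,
  so it amounts to scalar identities at forms. The matched pair axioms inside
  \<open>double_matched_pair\<close> are the standing hypotheses.\<close>

lemma double_matched_pair_iff:
  "double_matched_pair sA brA \<delta>A \<alpha>A sH brH \<delta>H \<alpha>H act ract \<phi> \<psi> \<longleftrightarrow>
    (\<forall>f. bilin sA sA (*) f \<longrightarrow> compat_AA f) \<and> (\<forall>f. bilin sH sH (*) f \<longrightarrow> compat_HH f) \<and>
    (\<forall>f. bilin sH sA (*) f \<longrightarrow> compat_HA f)"
  (is "?D \<longleftrightarrow> ?C")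
proof -
  note defs = compat_AA_def compat_HH_def compat_HA_def sweedler_def tens_def brL_def brR_def
  show ?thesis
  proof
    assume ?D
    then interpret double_matched_pair sA brA \<delta>A \<alpha>A sH brH \<delta>H \<alpha>H act ract \<phi> \<psi> .
    have "compat_AA f" if "bilin sA sA (*) f" for f
      using that BB5[THEN fun_cong, of _ _ f] BB9[THEN fun_cong, of _ _ f] by (simp add: defs)
    moreover have "compat_HH f" if "bilin sH sH (*) f" for f
      using that BB6[THEN fun_cong, of _ _ f] BB10[THEN fun_cong, of _ _ f] by (simp add: defs)
    moreover have "compat_HA f" if "bilin sH sA (*) f" for f
      using that BB7[THEN fun_cong, of _ _ f] BB8[THEN fun_cong, of _ _ f] YDB[THEN fun_cong, of _ _ f]
      by (simp add: defs)
    ultimately show ?C by blast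
  next
    note vanish = tensors[THEN tensor_space_eval(1)] tensors[THEN tensor_space_eval(2)]
    assume C: ?C
    show ?D
      \<comment> \<open>The remaining goals are BB5, BB6, BB7, BB8, BB9, BB10 and YDB, in this
        order.\<close>
      apply (unfold_locales; rule ext)
      subgoal for _ _ f using C by (cases "bilin sA sA (*) f") (simp_all add: defs vanish)
      subgoal for _ _ f using C by (cases "bilin sH sH (*) f") (simp_all add: defs vanish)
      subgoal for _ _ f using C by (cases "bilin sH sA (*) f") (simp_all add: defs vanish)
      subgoal for _ _ f using C by (cases "bilin sH sA (*) f") (simp_all add: defs vanish)
      subgoal for _ _ f using C by (cases "bilin sA sA (*) f") (simp_all add: defs vanish)
      subgoal for _ _ f using C by (cases "bilin sH sH (*) f") (simp_all add: defs vanish)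
      subgoal for _ _ f using C by (cases "bilin sH sA (*) f") (simp_all add: defs vanish)
      done
  qed
qed

text \<open>Necessity follows by testing on forms supported on one block, with each argument taken
  from a single summand. For sufficiency the four blocks of an arbitrary form are added up.\<close>

lemma biproduct_compat_iff:
  "(\<forall>X Y. \<delta>E (brE X Y) = brL sE brE \<alpha>E (\<alpha>E X) (\<delta>E Y) + brR sE brE \<alpha>E (\<delta>E X) (\<alpha>E Y)) \<longleftrightarrow>
    (\<forall>f. bilin sA sA (*) f \<longrightarrow> compat_AA f) \<and> (\<forall>f. bilin sH sH (*) f \<longrightarrow> compat_HH f) \<and>
    (\<forall>f. bilin sH sA (*) f \<longrightarrow> compat_HA f)"
  (is "?E \<longleftrightarrow> ?C")
proof
  assume compat: ?E
  have z: "bilin sA sA (*) (\<lambda>_ _. 0)" "bilin sA sH (*) (\<lambda>_ _. 0)" "bilin sH sA (*) (\<lambda>_ _. 0)"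
    "bilin sH sH (*) (\<lambda>_ _. 0)" by (simp_all add: bilin_iff spaces)
  have eq: "\<delta>E (brE (a, x) (b, y)) F =
      brL sE brE \<alpha>E (\<alpha>E (a, x)) (\<delta>E (b, y)) F + brR sE brE \<alpha>E (\<delta>E (a, x)) (\<alpha>E (b, y)) F" for a x b y F
    using compat by simp
  have "compat_AA f" if f: "bilin sA sA (*) f" for f
  proof -
    let ?F = "\<lambda>(a, x :: 'h) (b, y :: 'h). f a b"
    have F: "bilin sE sE (*) ?F" by (rule bilin_prodI[OF f z(2-4)]) simp
    note ev = eq[of _ _ _ _ ?F, unfolded compat_eval[OF F]]
    note ex = biproduct_bracket_def cobracket_eval[OF F] bilinD[OF f] additive evals bilin_iff spaces
      algebra_simps
    \<comment> \<open>The first argument in H and the second in A give BB5; both in A give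
      BB9.\<close>
    show ?thesis unfolding compat_AA_def
      using ev[of 0 _ _ 0] ev[of _ 0 _ 0] by (simp add: ex)
  qed
  moreover have "compat_HH f" if f: "bilin sH sH (*) f" for f
  proof -
    let ?F = "\<lambda>(a :: 'a, x) (b :: 'a, y). f x y"
    have F: "bilin sE sE (*) ?F" by (rule bilin_prodI[OF z(1-3) f]) simp
    note ev = eq[of _ _ _ _ ?F, unfolded compat_eval[OF F]]
    note ex = biproduct_bracket_def cobracket_eval[OF F] bilinD[OF f] additive evals bilin_iff spaces
      algebra_simps
    \<comment> \<open>The first argument in H and the second in A give BB6; both in H give
      BB10.\<close>
    show ?thesis unfolding compat_HH_def
      using ev[of 0 _ _ 0] ev[of 0 _ 0] by (simp add: ex)
  qed
  moreover have "compat_HA f" if f: "bilin sH sA (*) f" for f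
  proof -
    let ?F = "\<lambda>(a :: 'a, x) (b, y :: 'h). f x b"
    have F: "bilin sE sE (*) ?F" by (rule bilin_prodI[OF z(1,2) f z(4)]) simp
    note ev = eq[of _ _ _ _ ?F, unfolded compat_eval[OF F]]
    note ex = biproduct_bracket_def cobracket_eval[OF F] bilinD[OF f] additive evals bilin_iff spaces
      algebra_simps
    \<comment> \<open>Both arguments in A give BB7, both in H give BB8, and the first in H with the
      second in A gives YDB.\<close>
    show ?thesis unfolding compat_HA_def
      using ev[of _ 0 _ 0] ev[of 0 _ 0] ev[of 0 _ _ 0] by (simp add: ex)
  qed
  ultimately show ?C by blast
next
  note eE = tensor_space_eval[OF linear_to_tensorD(1)[OF linear_cobracket]]
  assume C: ?C
  show ?E
  proof (intro allI ext)
    fix X Y :: "'a \<times> 'h" and F :: "'a \<times> 'h \<Rightarrow> 'a \<times> 'h \<Rightarrow> 'k"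
    show "\<delta>E (brE X Y) F = (brL sE brE \<alpha>E (\<alpha>E X) (\<delta>E Y) + brR sE brE \<alpha>E (\<delta>E X) (\<alpha>E Y)) F"
    proof (cases "bilin sE sE (*) F")
      case False
      then show ?thesis by (simp add: brL_def brR_def sweedler_def tens_def eE)
    next
      case F: True
      obtain f_aa f_ah f_ha f_hh where
        f: "bilin sA sA (*) f_aa" "bilin sA sH (*) f_ah" "bilin sH sA (*) f_ha" "bilin sH sH (*) f_hh"
        and F_eq: "\<And>a x b y. F (a, x) (b, y) = f_aa a b + f_ah a y + f_ha x b + f_hh x y"
        using bilin_prodE[OF F spaces(1,2)] by blast
      obtain a x b y where XY: "X = (a, x)" "Y = (b, y)" by (metis prod.exhaust)
      note fD = bilinD[OF f(1)] bilinD[OF f(2)] bilinD[OF f(3)] bilinD[OF f(4)]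
      \<comment> \<open>The A x H block is covered by the H x A conditions at the transposed
        form.\<close>
      have f': "bilin sH sA (*) (\<lambda>u v. f_ah v u)" using f(2) by (rule bilin_swap[THEN iffD2])
      have c: "compat_AA f_aa" "compat_HH f_hh" "compat_HA f_ha" "compat_HA (\<lambda>u v. f_ah v u)"
        using C f f' by blast+
      note cs = c(1)[unfolded compat_AA_def] c(2)[unfolded compat_HH_def]
        c(3)[unfolded compat_HA_def] c(4)[unfolded compat_HA_def]
      note BB = cs(1)[THEN conjunct1, rule_format] cs(1)[THEN conjunct2, rule_format]
        cs(2)[THEN conjunct1, rule_format] cs(2)[THEN conjunct2, rule_format]
        cs(3,4)[THEN conjunct1, rule_format] cs(3,4)[THEN conjunct2, THEN conjunct1, rule_format]
        \<comment> \<open>YDB determines only a sum of a \<open>\<phi>\<close> and a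
          \<open>\<psi>\<close> term. Solved for the \<open>\<phi>\<close> term it can be
          substituted, and the \<open>\<psi>\<close> terms then cancel.\<close>
        cs(3,4)[THEN conjunct2, THEN conjunct2, rule_format, unfolded eq_diff_eq[symmetric]]
      \<comment> \<open>YDB at the transposed form has the two legs of \<open>\<delta>A\<close> and
        \<open>\<delta>H\<close> in the opposite order from the expansion in E; coskewness aligns
        them, and its sign matches the minus sign of the flipped terms in
        \<open>\<delta>E\<close>.\<close>
      have coskew_A': "\<delta>A a (\<lambda>u v. f_ah (\<alpha>A v) (\<alpha>H x \<triangleleft> u)) = - \<delta>A a (\<lambda>u v. f_ah (\<alpha>A u) (\<alpha>H x \<triangleleft> v))" for a x
        by (rule coskew_A[of "\<lambda>u v. f_ah (\<alpha>A u) (\<alpha>H x \<triangleleft> v)"]) (simp add: bilin_iff spaces fD additive)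
      have coskew_H': "\<delta>H x (\<lambda>u v. f_ah (v \<triangleright> \<alpha>A a) (\<alpha>H u)) = - \<delta>H x (\<lambda>u v. f_ah (u \<triangleright> \<alpha>A a) (\<alpha>H v))" for a x
        by (rule coskew_H[of "\<lambda>u v. f_ah (u \<triangleright> \<alpha>A a) (\<alpha>H v)"]) (simp add: bilin_iff spaces fD additive)
      \<comment> \<open>The mixed pair of \<open>y\<close> and \<open>a\<close> occurs with the two
        bracket arguments exchanged relative to YDB, hence the antisymmetry of both
        brackets.\<close>
      show ?thesis
        unfolding XY plus_fun_apply compat_eval[OF F]
        by (simp add: biproduct_bracket_def cobracket_eval[OF F] F_eq fD additive evals bilin_iff
            spaces algebra_simps BB coskew_A' coskew_H' A.skew[of "\<alpha>A _"] H.skew[of "\<alpha>H _"])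
    qed
  qed
qed

end

section \<open>The bialgebra criterion for the double biproduct\<close>

theorem theorem4p11:
  fixes sA :: "'k::alg_closed_field \<Rightarrow> 'a::ab_group_add \<Rightarrow> 'a"
    and sH :: "'k \<Rightarrow> 'h::ab_group_add \<Rightarrow> 'h"
    and brA :: "'a \<Rightarrow> 'a \<Rightarrow> 'a" and brH :: "'h \<Rightarrow> 'h \<Rightarrow> 'h"
    and \<delta>A :: "'a \<Rightarrow> ('a, 'a, 'k) tensor2" and \<delta>H :: "'h \<Rightarrow> ('h, 'h, 'k) tensor2"
    and \<alpha>A :: "'a \<Rightarrow> 'a" and \<alpha>H :: "'h \<Rightarrow> 'h"
    and act :: "'h \<Rightarrow> 'a \<Rightarrow> 'a" and ract :: "'h \<Rightarrow> 'a \<Rightarrow> 'h"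
    and \<phi> :: "'a \<Rightarrow> ('h, 'a, 'k) tensor2" and \<psi> :: "'h \<Rightarrow> ('h, 'a, 'k) tensor2"
  assumes "CHAR('k) \<noteq> 2" and "CHAR('k) \<noteq> 3"
    and "hom_lie_algebra sA brA \<alpha>A" and "hom_lie_coalgebra sA \<delta>A \<alpha>A"
    and "hom_lie_algebra sH brH \<alpha>H" and "hom_lie_coalgebra sH \<delta>H \<alpha>H"
    and "matched_pair_hom_lie_algebras sA brA \<alpha>A sH brH \<alpha>H act ract"
    and "matched_pair_hom_lie_coalgebras sA \<delta>A \<alpha>A sH \<delta>H \<alpha>H \<phi> \<psi>"
  shows "hom_lie_bialgebra (module_prod.scale sA sH)
           (biproduct_bracket brA brH act ract)
           (biproduct_cobracket sA sH \<delta>A \<delta>H \<phi> \<psi>)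
           (map_prod \<alpha>A \<alpha>H)
     \<longleftrightarrow> double_matched_pair sA brA \<delta>A \<alpha>A sH brH \<delta>H \<alpha>H act ract \<phi> \<psi>"
proof -
  interpret matched_pair_hom_lie_algebras sA brA \<alpha>A sH brH \<alpha>H act ract by fact
  interpret matched_pair_hom_lie_coalgebras sA \<delta>A \<alpha>A sH \<delta>H \<alpha>H \<phi> \<psi> by fact
  interpret biproduct sA brA \<delta>A \<alpha>A sH brH \<delta>H \<alpha>H act ract \<phi> \<psi> ..
  \<comment> \<open>The algebra and coalgebra structures on E come from the two matched pairs, so
    being a bialgebra reduces to the compatibility condition.\<close>
  show ?thesis
    unfolding double_matched_pair_iff biproduct_compat_iff[symmetric]
    by (simp add: hom_lie_bialgebra_def hom_lie_bialgebra_axioms_def hom_lie_algebra_biproduct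
        hom_lie_coalgebra_biproduct)
qed

end
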